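(* Let $S=\begin{bmatrix}A\&B\\ C\&D\end{bmatrix}$ be a Dirac node on $(\mathcal E,\mathcal X,\mathcal F)$ with unitary duality map $\psi:\mathcal F\to\mathcal E$, fix $\beta\in\mathbb C_+$ such that the map $\mathrm{dom}(S)\to\mathcal X\times\mathcal E$, $(x,e)\mapsto(x,\beta e+\psi\,C\&D(x,e))$, is injective, and let $P,G:[0,\infty)\to\mathcal L(\mathcal X)$ satisfy, for all $t\ge 0$ and all $z\in\mathcal X$: $P(t)=P(t)^*\ge 0$; $P(t)$ has an inverse in $\mathcal L(\mathcal X)$; $P(\cdot)z\in C^2([0,\infty);\mathcal X)$; $P(\cdot)^{-1}z,\,G(\cdot)z\in C^1([0,\infty);\mathcal X)$. Let $\mathcal V$ be the associated space of initial states and effort signals defined in the context. Then for every $(x_0,e)\in\mathcal V$ there is a unique classical solution $(e,x,f)$ on $[0,\infty)$ of $$\begin{bmatrix}\dot x(t)\\ f(t)\end{bmatrix}=\left(\begin{bmatrix}A\&B\\ C\&D\end{bmatrix}+\begin{bmatrix}G(t)P(t)^{-1}&0\\0&0\end{bmatrix}\right)\begin{bmatrix}P(t)x(t)\\ e(t)\end{bmatrix},\qquad t\ge 0,\qquad(\ast)$$ with $x(0)=x_0$ and the given effort signal $e$. (The flow satisfies $f\in H^1_{loc}([0,\infty);\mathcal F)$.)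
   Context: $\mathcal X,\mathcal E,\mathcal F$ are (all complex or all real) Hilbert spaces; $\mathcal L(\mathcal X)$ denotes the bounded linear operators on $\mathcal X$. $\mathcal E$ and $\mathcal F$ are dual, with unitary duality map $\psi:\mathcal F\to\mathcal E$, $\langle\psi f,e\rangle_{\mathcal E}=\langle f,e\rangle_{\mathcal F,\mathcal E}$. $\mathbb C_+:=\{z\in\mathbb C:\mathrm{Re}\,z>0\}$; for real spaces $\beta$ is understood to be in $(0,\infty)$. $\mathbb R_+:=[0,\infty)$. A linear operator $T$ on a Hilbert space is dissipative if $\mathrm{Re}\langle Th,h\rangle\le 0$ for all $h\in\mathrm{dom}(T)$, and maximal dissipative if moreover $\lambda I-T$ is onto for some (equivalently all) $\lambda>0$. A Dirac node on $(\mathcal E,\mathcal X,\mathcal F)$ is a linear operator $S=\begin{bmatrix}A\&B\\ C\&D\end{bmatrix}:\mathcal X\times\mathcal E\supset\mathrm{dom}(S)\to\mathcal X\times\mathcal F$ such that $\begin{bmatrix}A\&B\\-\psi C\&D\end{bmatrix}$, with domain $\mathrm{dom}(S)$, is maximal dissipative on $\mathcal X\times\mathcal E$, and such that for some $\beta\in\mathbb C_+$ the map $(x,e)\mapsto(x,\beta e+\psi\,C\&D(x,e))$ is injective on $\mathrm{dom}(S)$. A classical solution of $(\ast)$ is a triple $(e,x,f)\in H^1_{loc}(\mathbb R_+;\mathcal E)\times C^1(\mathbb R_+;\mathcal X)\times H^1_{loc}(\mathbb R_+;\mathcal F)$ such that $(P(t)x(t),e(t))\in\mathrm{dom}(S)$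 and $(\ast)$ holds for all $t\ge 0$. External Cayley transform: $$S^\times:=\begin{bmatrix}\sqrt{2\mathrm{Re}\beta}\,A\&B\\ \begin{bmatrix}0&\overline\beta I\end{bmatrix}-\psi C\&D\end{bmatrix}\begin{bmatrix}\sqrt{2\mathrm{Re}\beta}\begin{bmatrix}I&0\end{bmatrix}\\ \begin{bmatrix}0&\beta I\end{bmatrix}+\psi C\&D\end{bmatrix}^{-1},\qquad \mathrm{dom}(S^\times):=\begin{bmatrix}\sqrt{2\mathrm{Re}\beta}\begin{bmatrix}I&0\end{bmatrix}\\ \begin{bmatrix}0&\beta I\end{bmatrix}+\psi C\&D\end{bmatrix}\mathrm{dom}(S).$$ The scattering representation is $$\begin{bmatrix}\dot x(t)\\ y(t)\end{bmatrix}=\left(S^\times+\begin{bmatrix}G(t)P(t)^{-1}&0\\0&0\end{bmatrix}\right)\begin{bmatrix}P(t)x(t)\\ u(t)\end{bmatrix},\quad t\ge0,\qquad(\ast\ast)$$ obtained from $(\ast)$ by $u=(\beta e+\psi f)/\sqrt{2\mathrm{Re}\beta}$, $y=(\overline\beta e-\psi f)/\sqrt{2\mathrm{Re}\beta}$, equivalently $e=(u+y)/\sqrt{2\mathrm{Re}\beta}$, $f=(\overline\beta\psi^*u-\beta\psi^*y)/\sqrt{2\mathrm{Re}\beta}$. Its classical solutions $(u,x,y)\in H^1_{loc}(\mathbb R_+;\mathcal E)\times C^1(\mathbb R_+;\mathcal X)\times H^1_{loc}(\mathbb R_+;\mathcal E)$ are defined analogously, with $(P(t)x(t),u(t))\in\mathrm{dom}(S^\times)$.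 Put $$\mathcal V^\times:=\{(x_0,u)\in\mathcal X\times H^1_{loc}(\mathbb R_+;\mathcal E):\ (P(0)x_0,u(0))\in\mathrm{dom}(S^\times)\}.$$ A time-varying well-posed system on $\mathbb R_+$ with Hilbert input, state and output spaces $(\mathcal U,\mathcal X,\mathcal Y)$ is a quadruple of families of bounded operators, indexed by $(t,r)$ with $t\ge r\ge0$, $\mathbb T(t,r):\mathcal X\to\mathcal X$, $\Phi(t,r):L^2(\mathbb R_+;\mathcal U)\to\mathcal X$, $\Psi(t,r):\mathcal X\to L^2(\mathbb R_+;\mathcal Y)$, $\mathbb F(t,r):L^2(\mathbb R_+;\mathcal U)\to L^2(\mathbb R_+;\mathcal Y)$, such that, with $\mathbf P_{[r,t]}$ denoting multiplication by the indicator function of $[r,t]$: (1) $\mathbb T$ is an evolution family, i.e. $\mathbb T(t,t)=I$, $\mathbb T(t,s)\mathbb T(s,r)=\mathbb T(t,r)$, and $\mathbb T$ is jointly strongly continuous; (2) $\Phi(t,r)=\Phi(t,r)\mathbf P_{[r,t]}$, $\Psi(t,r)=\mathbf P_{[r,t]}\Psi(t,r)$, $\mathbb F(t,r)=\mathbf P_{[r,t]}\mathbb F(t,r)=\mathbb F(t,r)\mathbf P_{[r,t]}$; (3) all four families are locally uniformly bounded; (4) for $t\ge s\ge r\ge0$: $\Phi(t,r)=\Phi(t,s)+\mathbb T(t,s)\Phi(s,r)$, $\Psi(t,r)=\Psi(t,s)\mathbb T(s,r)+\Psi(s,r)$, $\mathbb F(t,r)=\mathbb F(t,s)+\mathbb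 F(s,r)+\Psi(t,s)\Phi(s,r)$. Its mild solution with initial state $x_0$ and input $u\in L^2_{loc}(\mathbb R_+;\mathcal U)$ is the triple $(u,x,y)\in L^2_{loc}(\mathbb R_+;\mathcal U)\times C(\mathbb R_+;\mathcal X)\times L^2_{loc}(\mathbb R_+;\mathcal Y)$ with $x(t)=\mathbb T(t,0)x_0+\Phi(t,0)u$, $\mathbf P_{[0,t]}y=\Psi(t,0)x_0+\mathbb F(t,0)u$ for $t\ge0$ (by causality, $u$ may be replaced by $\mathbf P_{[0,t]}u$). Known fact: under the hypotheses of the claim, there is a time-varying well-posed system $(\mathbb T,\Phi,\Psi,\mathbb F)$ with spaces $(\mathcal E,\mathcal X,\mathcal E)$ such that for every $(x_0,u)\in\mathcal V^\times$ there is a unique classical solution $(u,x,y)$ of $(\ast\ast)$ with $x(0)=x_0$ and input $u$, with $y\in H^1_{loc}(\mathbb R_+;\mathcal E)$, and $(u,x,y)$ is also the unique mild solution of $(\mathbb T,\Phi,\Psi,\mathbb F)$ with initial state $x_0$ and input $u$. With $\Psi^\times:=\Psi$, $\mathbb F^\times:=\mathbb F$ from this system, define (limit in $\mathcal X\times L^2_{loc}(\mathbb R_+;\mathcal E)$) $$\mathcal V:=\lim_{t\to\infty}\begin{bmatrix}\sqrt{2\mathrm{Re}\beta}\,I&0\\ \Psi^\times(t,0)&I+\mathbb F^\times(t,0)\mathbf P_{[0,t]}\end{bmatrix}\mathcal V^\times,$$ i.e. $\mathcal V$ is the set of limits as $t\to\infty$ of $\big(\sqrt{2\mathrm{Re}\beta}\,x_0,\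 \Psi^\times(t,0)x_0+u+\mathbb F^\times(t,0)\mathbf P_{[0,t]}u\big)$, where $(x_0,u)$ ranges over $\mathcal V^\times$. *)

theory Defs
  imports "HOL-Analysis.Analysis"
begin

text \<open>
  Real and complex Hilbert spaces are treated uniformly. The scalar field is a set \<open>K\<close> of complex
  numbers, either \<open>\<real>\<close> or \<open>UNIV\<close>. A Hilbert space over \<open>K\<close> consists of a type of class \<open>real_inner\<close>
  and \<open>complete_space\<close> (the underlying real Hilbert space, which provides norm, topology, derivatives
  and integrals) and a multiplication by scalars from \<open>K\<close> with a \<open>K\<close>-valued inner product, linear
  in the first argument, inducing that same norm. Values \<open>sc H a x\<close> with \<open>a \<notin> K\<close> play no role.
\<close>

record 'a kspace =
  sc :: "complex \<Rightarrow> 'a \<Rightarrow> 'a"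
  ip :: "'a \<Rightarrow> 'a \<Rightarrow> complex"

definition hilbert :: "complex set \<Rightarrow> 'a::{real_inner,complete_space} kspace \<Rightarrow> bool" where
  "hilbert K H \<longleftrightarrow>
     (\<forall>a\<in>K. \<forall>x y. sc H a (x + y) = sc H a x + sc H a y) \<and>
     (\<forall>a\<in>K. \<forall>b\<in>K. \<forall>x. sc H (a + b) x = sc H a x + sc H b x) \<and>
     (\<forall>a\<in>K. \<forall>b\<in>K. \<forall>x. sc H (a * b) x = sc H a (sc H b x)) \<and>
     (\<forall>r x. sc H (complex_of_real r) x = r *\<^sub>R x) \<and>
     (\<forall>x y. ip H x y \<in> K) \<and>
     (\<forall>x y z. ip H (x + y) z = ip H x z + ip H y z) \<and>
     (\<forall>a\<in>K. \<forall>x y. ip H (sc H a x) y = a * ip H x y) \<and>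
     (\<forall>x y. ip H y x = cnj (ip H x y)) \<and>
     (\<forall>x. ip H x x = complex_of_real ((norm x)\<^sup>2))"

definition prod_kspace :: "'a kspace \<Rightarrow> 'b kspace \<Rightarrow> ('a \<times> 'b) kspace" where
  "prod_kspace H L =
     \<lparr> sc = (\<lambda>a (x, y). (sc H a x, sc L a y)),
       ip = (\<lambda>(x, y) (x', y'). ip H x x' + ip L y y') \<rparr>"

text \<open>
  An operator with domain \<open>D\<close> is a pair of the set \<open>D\<close> and a total function of which only
  the values on \<open>D\<close> matter.
\<close>

definition linear_op ::
  "complex set \<Rightarrow> 'a::real_vector kspace \<Rightarrow> 'b::real_vector kspace \<Rightarrow> 'a set \<Rightarrow> ('a \<Rightarrow> 'b) \<Rightarrow> bool"
  where
  "linear_op K H L D T \<longleftrightarrow>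
     0 \<in> D \<and>
     (\<forall>x\<in>D. \<forall>y\<in>D. x + y \<in> D \<and> T (x + y) = T x + T y) \<and>
     (\<forall>a\<in>K. \<forall>x\<in>D. sc H a x \<in> D \<and> T (sc H a x) = sc L a (T x))"

definition bounded_op ::
  "complex set \<Rightarrow> 'a::real_normed_vector kspace \<Rightarrow> 'b::real_normed_vector kspace \<Rightarrow> ('a \<Rightarrow> 'b) \<Rightarrow> bool"
  where
  "bounded_op K H L T \<longleftrightarrow> linear_op K H L UNIV T \<and> (\<exists>C. \<forall>x. norm (T x) \<le> C * norm x)"

definition unitary_op ::
  "complex set \<Rightarrow> 'a::real_vector kspace \<Rightarrow> 'b::real_vector kspace \<Rightarrow> ('a \<Rightarrow> 'b) \<Rightarrow> bool" where
  "unitary_op K H L U \<longleftrightarrow>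
     linear_op K H L UNIV U \<and> surj U \<and> (\<forall>x y. ip L (U x) (U y) = ip H x y)"

definition dissipative :: "'a kspace \<Rightarrow> 'a set \<Rightarrow> ('a \<Rightarrow> 'a) \<Rightarrow> bool" where
  "dissipative H D T \<longleftrightarrow> (\<forall>h\<in>D. Re (ip H (T h) h) \<le> 0)"

definition maximal_dissipative ::
  "complex set \<Rightarrow> 'a::real_vector kspace \<Rightarrow> 'a set \<Rightarrow> ('a \<Rightarrow> 'a) \<Rightarrow> bool" where
  "maximal_dissipative K H D T \<longleftrightarrow>
     linear_op K H H D T \<and> dissipative H D T \<and>
     (\<exists>l>0. (\<lambda>h. l *\<^sub>R h - T h) ` D = UNIV)"

text \<open>
  For \<open>S :: 'x \<times> 'e \<Rightarrow> 'x \<times> 'f\<close> the rows \<open>A&B\<close> and \<open>C&D\<close> are \<open>fst \<circ> S\<close> and \<open>snd \<circ> S\<close>. The duality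
  pairing of \<open>'f\<close> and \<open>'e\<close> is \<open>\<lambda>f e. ip E (\<psi> f) e\<close>, so it is determined by the unitary map \<open>\<psi>\<close>.
\<close>

definition cayley_injective ::
  "'e::real_vector kspace \<Rightarrow> ('f \<Rightarrow> 'e) \<Rightarrow> complex \<Rightarrow> ('x \<times> 'e) set \<Rightarrow> ('x \<times> 'e \<Rightarrow> 'x \<times> 'f) \<Rightarrow> bool"
  where
  "cayley_injective E \<psi> \<beta> D S \<longleftrightarrow>
     inj_on (\<lambda>(x, e). (x, sc E \<beta> e + \<psi> (snd (S (x, e))))) D"

definition dirac_node ::
  "complex set \<Rightarrow> 'x::real_vector kspace \<Rightarrow> 'e::real_vector kspace \<Rightarrow> 'f::real_vector kspace \<Rightarrow>
   ('f \<Rightarrow> 'e) \<Rightarrow> ('x \<times> 'e) set \<Rightarrow> ('x \<times> 'e \<Rightarrow> 'x \<times> 'f) \<Rightarrow> bool" where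
  "dirac_node K X E F \<psi> D S \<longleftrightarrow>
     linear_op K (prod_kspace X E) (prod_kspace X F) D S \<and>
     maximal_dissipative K (prod_kspace X E) D (\<lambda>w. (fst (S w), - \<psi> (snd (S w)))) \<and>
     (\<exists>\<beta>\<in>K. Re \<beta> > 0 \<and> cayley_injective E \<psi> \<beta> D S)"

definition cayley_map ::
  "'e::real_vector kspace \<Rightarrow> ('f \<Rightarrow> 'e) \<Rightarrow> complex \<Rightarrow> ('x::real_vector \<times> 'e \<Rightarrow> 'x \<times> 'f) \<Rightarrow>
   'x \<times> 'e \<Rightarrow> 'x \<times> 'e" where
  "cayley_map E \<psi> \<beta> S = (\<lambda>(x, e). (sqrt (2 * Re \<beta>) *\<^sub>R x, sc E \<beta> e + \<psi> (snd (S (x, e)))))"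

definition cayley_dom ::
  "'e::real_vector kspace \<Rightarrow> ('f \<Rightarrow> 'e) \<Rightarrow> complex \<Rightarrow> ('x::real_vector \<times> 'e) set \<Rightarrow>
   ('x \<times> 'e \<Rightarrow> 'x \<times> 'f) \<Rightarrow> ('x \<times> 'e) set" where
  "cayley_dom E \<psi> \<beta> D S = cayley_map E \<psi> \<beta> S ` D"

definition cayley_op ::
  "'e::real_vector kspace \<Rightarrow> ('f \<Rightarrow> 'e) \<Rightarrow> complex \<Rightarrow> ('x::real_vector \<times> 'e) set \<Rightarrow>
   ('x \<times> 'e \<Rightarrow> 'x \<times> 'f) \<Rightarrow> 'x \<times> 'e \<Rightarrow> 'x \<times> 'e" where
  "cayley_op E \<psi> \<beta> D S z =
     (let w = inv_into D (cayley_map E \<psi> \<beta> S) z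
      in (sqrt (2 * Re \<beta>) *\<^sub>R fst (S w), sc E (cnj \<beta>) (snd w) - \<psi> (snd (S w))))"

text \<open>
  Functions on the half-line are functions on \<open>real\<close> of which only the values on \<open>{0..}\<close> matter.
  Elements of \<open>L\<^sup>2\<close> are represented by functions, and equality in \<open>L\<^sup>2\<close> is equality almost everywhere.
  The Hilbert spaces need not be separable, so measurability is strong (Bochner) measurability.
\<close>

definition strongly_measurable :: "'t measure \<Rightarrow> ('t \<Rightarrow> 'a::topological_space) \<Rightarrow> bool" where
  "strongly_measurable M f \<longleftrightarrow>
     (\<exists>s. (\<forall>n::nat. simple_function M (s n)) \<and> (AE t in M. (\<lambda>n. s n t) \<longlonglongrightarrow> f t))"

definition L2_on :: "real set \<Rightarrow> (real \<Rightarrow> 'a::real_normed_vector) \<Rightarrow> bool" where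
  "L2_on I f \<longleftrightarrow> strongly_measurable (lebesgue_on I) f \<and>
     (\<integral>\<^sup>+t. ennreal ((norm (f t))\<^sup>2) \<partial>lebesgue_on I) < \<infinity>"

definition L2_norm_on :: "real set \<Rightarrow> (real \<Rightarrow> 'a::real_normed_vector) \<Rightarrow> real" where
  "L2_norm_on I f = sqrt (enn2real (\<integral>\<^sup>+t. ennreal ((norm (f t))\<^sup>2) \<partial>lebesgue_on I))"

definition ae_eq :: "(real \<Rightarrow> 'a) \<Rightarrow> (real \<Rightarrow> 'a) \<Rightarrow> bool" where
  "ae_eq f g \<longleftrightarrow> (AE t in lebesgue_on {0..}. f t = g t)"

definition L2_loc :: "(real \<Rightarrow> 'a::real_normed_vector) \<Rightarrow> bool" where
  "L2_loc f \<longleftrightarrow> (\<forall>\<tau>\<ge>0. L2_on {0..\<tau>} f)"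

text \<open>
  The continuous representatives of \<open>H\<^sup>1\<close>-functions: primitives of \<open>L\<^sup>2\<close>-functions. For a strongly
  measurable function with integrable norm, the gauge integral below is the Bochner integral.
\<close>

definition H1_loc :: "(real \<Rightarrow> 'a::real_normed_vector) \<Rightarrow> bool" where
  "H1_loc f \<longleftrightarrow> (\<exists>g. L2_loc g \<and> (\<forall>t\<ge>0. (g has_integral (f t - f 0)) {0..t}))"

definition C1_halfline :: "(real \<Rightarrow> 'a::real_normed_vector) \<Rightarrow> bool" where
  "C1_halfline f \<longleftrightarrow>
     (\<exists>g. (\<forall>t\<ge>0. (f has_vector_derivative g t) (at t within {0..})) \<and> continuous_on {0..} g)"

definition C2_halfline :: "(real \<Rightarrow> 'a::real_normed_vector) \<Rightarrow> bool" where
  "C2_halfline f \<longleftrightarrow>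
     (\<exists>g. (\<forall>t\<ge>0. (f has_vector_derivative g t) (at t within {0..})) \<and> C1_halfline g)"

text \<open>
  Used both for \<open>(e, x, f)\<close> with \<open>S\<close> and for \<open>(u, x, y)\<close> with its external Cayley transform.
\<close>

definition classical_solution ::
  "('x::real_normed_vector \<times> 'u::real_normed_vector) set \<Rightarrow>
   ('x \<times> 'u \<Rightarrow> 'x \<times> 'y::real_normed_vector) \<Rightarrow>
   (real \<Rightarrow> 'x \<Rightarrow> 'x) \<Rightarrow> (real \<Rightarrow> 'x \<Rightarrow> 'x) \<Rightarrow>
   (real \<Rightarrow> 'u) \<Rightarrow> (real \<Rightarrow> 'x) \<Rightarrow> (real \<Rightarrow> 'y) \<Rightarrow> bool" where
  "classical_solution D S P G e x f \<longleftrightarrow>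
     H1_loc e \<and> C1_halfline x \<and> H1_loc f \<and>
     (\<forall>t\<ge>0. (P t (x t), e t) \<in> D \<and>
        (x has_vector_derivative
           (fst (S (P t (x t), e t)) + G t (inv (P t) (P t (x t))))) (at t within {0..}) \<and>
        f t = snd (S (P t (x t), e t)))"

definition cut :: "real \<Rightarrow> real \<Rightarrow> (real \<Rightarrow> 'a::real_vector) \<Rightarrow> real \<Rightarrow> 'a" where
  "cut r t u = (\<lambda>s. indicat_real {r..t} s *\<^sub>R u s)"

text \<open>
  Bounded operators between \<open>L\<^sup>2\<close> of the half-line and the state space. Boundedness makes them
  independent of the chosen representatives.
\<close>

definition bounded_from_L2 ::
  "complex set \<Rightarrow> 'u::real_normed_vector kspace \<Rightarrow> 'x::real_normed_vector kspace \<Rightarrow>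
   ((real \<Rightarrow> 'u) \<Rightarrow> 'x) \<Rightarrow> bool" where
  "bounded_from_L2 K U X T \<longleftrightarrow>
     (\<forall>u v. L2_on {0..} u \<longrightarrow> L2_on {0..} v \<longrightarrow> T (\<lambda>s. u s + v s) = T u + T v) \<and>
     (\<forall>a\<in>K. \<forall>u. L2_on {0..} u \<longrightarrow> T (\<lambda>s. sc U a (u s)) = sc X a (T u)) \<and>
     (\<exists>C. \<forall>u. L2_on {0..} u \<longrightarrow> norm (T u) \<le> C * L2_norm_on {0..} u)"

definition bounded_into_L2 ::
  "complex set \<Rightarrow> 'x::real_normed_vector kspace \<Rightarrow> 'y::real_normed_vector kspace \<Rightarrow>
   ('x \<Rightarrow> real \<Rightarrow> 'y) \<Rightarrow> bool" where
  "bounded_into_L2 K X Y T \<longleftrightarrow>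
     (\<forall>x. L2_on {0..} (T x)) \<and>
     (\<forall>x z. ae_eq (T (x + z)) (\<lambda>s. T x s + T z s)) \<and>
     (\<forall>a\<in>K. \<forall>x. ae_eq (T (sc X a x)) (\<lambda>s. sc Y a (T x s))) \<and>
     (\<exists>C. \<forall>x. L2_norm_on {0..} (T x) \<le> C * norm x)"

definition bounded_L2_L2 ::
  "complex set \<Rightarrow> 'u::real_normed_vector kspace \<Rightarrow> 'y::real_normed_vector kspace \<Rightarrow>
   ((real \<Rightarrow> 'u) \<Rightarrow> real \<Rightarrow> 'y) \<Rightarrow> bool" where
  "bounded_L2_L2 K U Y T \<longleftrightarrow>
     (\<forall>u. L2_on {0..} u \<longrightarrow> L2_on {0..} (T u)) \<and>
     (\<forall>u v. L2_on {0..} u \<longrightarrow> L2_on {0..} v \<longrightarrow>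
        ae_eq (T (\<lambda>s. u s + v s)) (\<lambda>s. T u s + T v s)) \<and>
     (\<forall>a\<in>K. \<forall>u. L2_on {0..} u \<longrightarrow> ae_eq (T (\<lambda>s. sc U a (u s))) (\<lambda>s. sc Y a (T u s))) \<and>
     (\<exists>C. \<forall>u. L2_on {0..} u \<longrightarrow> L2_norm_on {0..} (T u) \<le> C * L2_norm_on {0..} u)"

record ('u, 'x, 'y) tv_system =
  evol :: "real \<Rightarrow> real \<Rightarrow> 'x \<Rightarrow> 'x"
  input_map :: "real \<Rightarrow> real \<Rightarrow> (real \<Rightarrow> 'u) \<Rightarrow> 'x"
  output_map :: "real \<Rightarrow> real \<Rightarrow> 'x \<Rightarrow> real \<Rightarrow> 'y"
  io_map :: "real \<Rightarrow> real \<Rightarrow> (real \<Rightarrow> 'u) \<Rightarrow> real \<Rightarrow> 'y"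

definition well_posed_system ::
  "complex set \<Rightarrow> 'u::real_normed_vector kspace \<Rightarrow> 'x::real_normed_vector kspace \<Rightarrow>
   'y::real_normed_vector kspace \<Rightarrow> ('u, 'x, 'y) tv_system \<Rightarrow> bool" where
  "well_posed_system K U X Y \<Sigma> \<longleftrightarrow>
     (\<forall>r t. 0 \<le> r \<and> r \<le> t \<longrightarrow>
        bounded_op K X X (evol \<Sigma> t r) \<and>
        bounded_from_L2 K U X (input_map \<Sigma> t r) \<and>
        bounded_into_L2 K X Y (output_map \<Sigma> t r) \<and>
        bounded_L2_L2 K U Y (io_map \<Sigma> t r)) \<and>
     (\<forall>t\<ge>0. \<forall>x. evol \<Sigma> t t x = x) \<and>
     (\<forall>r s t x. 0 \<le> r \<and> r \<le> s \<and> s \<le> t \<longrightarrow> evol \<Sigma> t s (evol \<Sigma> s r x) = evol \<Sigma> t r x) \<and>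
     (\<forall>x. continuous_on {(t, r). 0 \<le> r \<and> r \<le> t} (\<lambda>(t, r). evol \<Sigma> t r x)) \<and>
     (\<forall>r t. 0 \<le> r \<and> r \<le> t \<longrightarrow>
        (\<forall>u. L2_on {0..} u \<longrightarrow> input_map \<Sigma> t r u = input_map \<Sigma> t r (cut r t u)) \<and>
        (\<forall>x. ae_eq (output_map \<Sigma> t r x) (cut r t (output_map \<Sigma> t r x))) \<and>
        (\<forall>u. L2_on {0..} u \<longrightarrow>
           ae_eq (io_map \<Sigma> t r u) (cut r t (io_map \<Sigma> t r u)) \<and>
           ae_eq (io_map \<Sigma> t r u) (io_map \<Sigma> t r (cut r t u)))) \<and>
     (\<forall>\<tau>\<ge>0. \<exists>C. \<forall>r t. 0 \<le> r \<and> r \<le> t \<and> t \<le> \<tau> \<longrightarrow>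
        (\<forall>x. norm (evol \<Sigma> t r x) \<le> C * norm x) \<and>
        (\<forall>u. L2_on {0..} u \<longrightarrow> norm (input_map \<Sigma> t r u) \<le> C * L2_norm_on {0..} u) \<and>
        (\<forall>x. L2_norm_on {0..} (output_map \<Sigma> t r x) \<le> C * norm x) \<and>
        (\<forall>u. L2_on {0..} u \<longrightarrow> L2_norm_on {0..} (io_map \<Sigma> t r u) \<le> C * L2_norm_on {0..} u)) \<and>
     (\<forall>r s t. 0 \<le> r \<and> r \<le> s \<and> s \<le> t \<longrightarrow>
        (\<forall>u. L2_on {0..} u \<longrightarrow>
           input_map \<Sigma> t r u = input_map \<Sigma> t s u + evol \<Sigma> t s (input_map \<Sigma> s r u)) \<and>
        (\<forall>x. ae_eq (output_map \<Sigma> t r x)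
               (\<lambda>\<sigma>. output_map \<Sigma> t s (evol \<Sigma> s r x) \<sigma> + output_map \<Sigma> s r x \<sigma>)) \<and>
        (\<forall>u. L2_on {0..} u \<longrightarrow>
           ae_eq (io_map \<Sigma> t r u)
             (\<lambda>\<sigma>. io_map \<Sigma> t s u \<sigma> + io_map \<Sigma> s r u \<sigma>
                   + output_map \<Sigma> t s (input_map \<Sigma> s r u) \<sigma>)))"

definition mild_solution ::
  "('u::real_normed_vector, 'x::real_normed_vector, 'y::real_normed_vector) tv_system \<Rightarrow> 'x \<Rightarrow>
   (real \<Rightarrow> 'u) \<Rightarrow> (real \<Rightarrow> 'x) \<Rightarrow> (real \<Rightarrow> 'y) \<Rightarrow> bool" where
  "mild_solution \<Sigma> x0 u x y \<longleftrightarrow>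
     L2_loc u \<and> continuous_on {0..} x \<and> L2_loc y \<and>
     (\<forall>t\<ge>0. x t = evol \<Sigma> t 0 x0 + input_map \<Sigma> t 0 (cut 0 t u) \<and>
        ae_eq (cut 0 t y) (\<lambda>s. output_map \<Sigma> t 0 x0 s + io_map \<Sigma> t 0 (cut 0 t u) s))"

definition scattering_data ::
  "('x \<times> 'u::real_normed_vector) set \<Rightarrow> (real \<Rightarrow> 'x \<Rightarrow> 'x) \<Rightarrow> ('x \<times> (real \<Rightarrow> 'u)) set" where
  "scattering_data D P = {(x0, u). H1_loc u \<and> (P 0 x0, u 0) \<in> D}"

text \<open>
  \<open>\<Sigma>\<close> is a well-posed system that represents the node \<open>(D, S)\<close> perturbed by \<open>P\<close> and \<open>G\<close>: for
  compatible data there is a unique classical solution, and it is also the unique mild solution.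
\<close>

definition represents ::
  "complex set \<Rightarrow> 'u::real_normed_vector kspace \<Rightarrow> 'x::real_normed_vector kspace \<Rightarrow>
   'y::real_normed_vector kspace \<Rightarrow> ('x \<times> 'u) set \<Rightarrow> ('x \<times> 'u \<Rightarrow> 'x \<times> 'y) \<Rightarrow>
   (real \<Rightarrow> 'x \<Rightarrow> 'x) \<Rightarrow> (real \<Rightarrow> 'x \<Rightarrow> 'x) \<Rightarrow> ('u, 'x, 'y) tv_system \<Rightarrow> bool" where
  "represents K U X Y D S P G \<Sigma> \<longleftrightarrow>
     well_posed_system K U X Y \<Sigma> \<and>
     (\<forall>(x0, u) \<in> scattering_data D P. \<exists>x y.
        classical_solution D S P G u x y \<and> x 0 = x0 \<and> mild_solution \<Sigma> x0 u x y \<and>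
        (\<forall>x' y'. classical_solution D S P G u x' y' \<and> x' 0 = x0 \<longrightarrow>
           (\<forall>t\<ge>0. x' t = x t \<and> y' t = y t)) \<and>
        (\<forall>x' y'. mild_solution \<Sigma> x0 u x' y' \<longrightarrow> (\<forall>t\<ge>0. x' t = x t) \<and> ae_eq y' y))"

text \<open>
  The space of initial states and effort signals. The limit is taken in the product of the state
  space with \<open>L\<^sup>2\<^sub>l\<^sub>o\<^sub>c\<close>, whose topology is given by the \<open>L\<^sup>2\<close>-seminorms on the intervals \<open>{0..\<tau>}\<close>; the
  set contains all representatives \<open>w\<close> of the limit.
\<close>

definition effort_data ::
  "complex \<Rightarrow> ('x::real_normed_vector \<times> (real \<Rightarrow> 'e::real_normed_vector)) set \<Rightarrow>
   ('e, 'x, 'e) tv_system \<Rightarrow> ('x \<times> (real \<Rightarrow> 'e)) set" where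
  "effort_data \<beta> V \<Sigma> =
     {(z, w). L2_loc w \<and> (\<exists>(x0, u) \<in> V.
        ((\<lambda>t::real. sqrt (2 * Re \<beta>) *\<^sub>R x0) \<longlongrightarrow> z) at_top \<and>
        (\<forall>\<tau>\<ge>0. ((\<lambda>t::real. L2_norm_on {0..\<tau>}
             (\<lambda>s. output_map \<Sigma> t 0 x0 s + u s + io_map \<Sigma> t 0 (cut 0 t u) s - w s))
           \<longlongrightarrow> 0) at_top))}"

end

theory Submission
  imports Defs
begin

text \<open>
  Existence. Scaling the inverse Cayley relations by \<open>2 Re \<beta>\<close> turns a scattering solution \<open>(u, x, y)\<close>
  into the effort solution with state \<open>sqrt (2 Re \<beta>) x\<close>, effort \<open>e = u + y\<close> and flow \<open>f\<close> given by
  \<open>\<psi> f = cnj \<beta> u - \<beta> y\<close>. Since the scattering solution is also a mild one, the limit that defines the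
  effort data is \<open>u + y\<close> almost everywhere.

  Uniqueness. The difference \<open>d\<close> of two solutions with the same effort has zero effort, so dissipativity
  of the node bounds the derivative of the energy \<open>\<langle>P d, d\<rangle>\<close> by a multiple of \<open>\<parallel>d\<parallel>\<^sup>2\<close>, locally uniformly
  in time by the uniform boundedness principle. As \<open>P\<close> has a locally bounded inverse, \<open>\<langle>P d, d\<rangle>\<close>
  dominates \<open>\<parallel>d\<parallel>\<^sup>2\<close>, and the Gronwall inequality gives \<open>d = 0\<close>.
\<close>

section \<open>Uniform bounds for strongly C1 operator families\<close>

text \<open>This is a Baire category argument: the closed sets \<open>A n\<close>, on which the
  whole family is bounded by \<open>n\<close>, cover the space, so one of them contains a ball, and
  differences of points of that ball control every direction. The bound \<open>C * norm x\<close> is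
  uniform over the family.\<close>

lemma uniform_boundedness:
  fixes T :: "'i \<Rightarrow> 'a::{real_normed_vector,complete_space} \<Rightarrow> 'b::real_normed_vector"
  assumes lin: "\<And>i. i \<in> I \<Longrightarrow> bounded_linear (T i)"
    and bdd: "\<And>x. \<exists>B. \<forall>i\<in>I. norm (T i x) \<le> B"
  shows "\<exists>C\<ge>0. \<forall>i\<in>I. \<forall>x. norm (T i x) \<le> C * norm x"
proof -
  define A where "A n = {x. \<forall>i\<in>I. norm (T i x) \<le> real n}" for n
  have "closed (A n)" for n
  proof -
    have "A n = (\<Inter>i\<in>I. {x. norm (T i x) \<le> real n})"
      by (auto simp: A_def)
    moreover have "closed {x. norm (T i x) \<le> real n}" if "i \<in> I" for i
      using lin[OF that] by (intro closed_Collect_le continuous_intros linear_continuous_on)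
    ultimately show ?thesis by auto
  qed
  moreover have "\<Union> (range A) = UNIV"
  proof (intro equalityI subset_UNIV subsetI)
    fix x
    obtain B where B: "\<forall>i\<in>I. norm (T i x) \<le> B" using bdd by blast
    obtain n where "B \<le> real n" using real_arch_simple by blast
    with B have "x \<in> A n" by (force simp: A_def)
    then show "x \<in> \<Union> (range A)" by blast
  qed
  ultimately obtain n where "interior (A n) \<noteq> {}"
    using Baire_category_alt[of euclidean "range A"]
      completely_metrizable_space_euclidean[where 'a='a] by fastforce
  then obtain a r where r: "r > 0" "cball a r \<subseteq> A n"
    by (meson ex_in_conv mem_interior_cball)
  have "norm (T i x) \<le> (2 * real n / r) * norm x" if i: "i \<in> I" for i x
  proof (cases "x = 0")
    case True
    then show ?thesis using lin[OF i] by (simp add: linear_simps)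
  next
    case False
    \<comment> \<open>With this scaling \<open>a + c *\<^sub>R x\<close> lies on the sphere of
      radius \<open>r\<close> around \<open>a\<close>, so \<open>T i (c *\<^sub>R x)\<close> is a
      difference of two values of norm at most \<open>n\<close>. This produces the constant
      \<open>2 * real n / r\<close>.\<close>
    define c where "c = r / norm x"
    have c: "c > 0" using False r by (simp add: c_def)
    have "a + c *\<^sub>R x \<in> cball a r" "a \<in> cball a r"
      using r False by (auto simp: c_def dist_norm)
    then have "a + c *\<^sub>R x \<in> A n" "a \<in> A n"
      using r by blast+
    then have "norm (T i (a + c *\<^sub>R x)) \<le> n" "norm (T i a) \<le> n"
      using i by (auto simp: A_def)
    moreover have "T i (a + c *\<^sub>R x) = T i a + c *\<^sub>R T i x"
      using lin[OF i] by (simp add: linear_simps)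
    ultimately have "norm (c *\<^sub>R T i x) \<le> 2 * n"
      using norm_triangle_ineq4[of "T i (a + c *\<^sub>R x)" "T i a"] by simp
    then show ?thesis using c False r by (simp add: c_def field_simps)
  qed
  then show ?thesis using r by (intro exI[of _ "2 * real n / r"]) auto
qed

lemma C2_halfline_imp_C1_halfline: "C2_halfline f \<Longrightarrow> C1_halfline f"
  unfolding C2_halfline_def C1_halfline_def
  by (meson continuous_on_eq_continuous_within has_vector_derivative_continuous atLeast_iff)

text \<open>The continuous derivative is bounded on a compact interval, and the mean value
  inequality turns this bound into a Lipschitz constant.\<close>

lemma C1_halfline_lipschitz:
  assumes "C1_halfline f"
  shows "\<exists>B. \<forall>s\<in>{0..\<tau>}. \<forall>t\<in>{0..\<tau>}. norm (f t - f s) \<le> B * \<bar>t - s\<bar>"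
proof -
  from assms obtain g where
    g: "\<And>t. t \<ge> 0 \<Longrightarrow> (f has_vector_derivative g t) (at t within {0..})" "continuous_on {0..} g"
    by (auto simp: C1_halfline_def)
  have "compact (g ` {0..\<tau>})"
    by (intro compact_continuous_image continuous_on_subset[OF g(2)]) auto
  then obtain B where B: "\<And>t. t \<in> {0..\<tau>} \<Longrightarrow> norm (g t) \<le> B"
    by (meson bounded_iff compact_imp_bounded imageI)
  have "norm (f t - f s) \<le> B * norm (t - s)" if "s \<in> {0..\<tau>}" "t \<in> {0..\<tau>}" for s t
  proof (rule differentiable_bound[where S = "{0..\<tau>}" and f' = "\<lambda>r h. h *\<^sub>R g r"])
    fix r assume r: "r \<in> {0..\<tau>}"
    show "(f has_derivative (\<lambda>h. h *\<^sub>R g r)) (at r within {0..\<tau>})"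
      using has_vector_derivative_within_subset[OF g(1)[of r], of "{0..\<tau>}"] r
      by (auto simp: has_vector_derivative_def)
    have "norm (h *\<^sub>R g r) \<le> B * norm h" for h
      using mult_left_mono[OF B[OF r] abs_ge_zero[of h]] by (simp add: mult.commute)
    then show "onorm (\<lambda>h. h *\<^sub>R g r) \<le> B" by (intro onorm_bound) (use B[OF r] norm_ge_zero order_trans in blast)+
  qed (use that in auto)
  then show ?thesis by (metis real_norm_def)
qed

text \<open>The difference quotients, indexed by pairs of times, are pointwise bounded because each
  orbit is Lipschitz. Uniform boundedness then upgrades strong differentiability to Lipschitz
  continuity in operator norm.\<close>

lemma C1_family_lipschitz:
  fixes T :: "real \<Rightarrow> 'a::{real_normed_vector,complete_space} \<Rightarrow> 'b::real_normed_vector"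
  assumes lin: "\<And>t. t \<ge> 0 \<Longrightarrow> bounded_linear (T t)"
    and C1: "\<And>z. C1_halfline (\<lambda>t. T t z)"
  shows "\<exists>C\<ge>0. \<forall>s\<in>{0..\<tau>}. \<forall>t\<in>{0..\<tau>}. \<forall>z. norm (T t z - T s z) \<le> C * \<bar>t - s\<bar> * norm z"
proof -
  \<comment> \<open>The index set includes the diagonal: there \<open>inverse 0 = 0\<close> makes
    the quotient the zero operator.\<close>
  have "\<exists>C\<ge>0. \<forall>p\<in>{0..\<tau>} \<times> {0..\<tau>}. \<forall>z.
      norm (inverse (snd p - fst p) *\<^sub>R (T (snd p) z - T (fst p) z)) \<le> C * norm z"
  proof (rule uniform_boundedness)
    fix p assume "p \<in> {0..\<tau>} \<times> {0..\<tau>}"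
    then show "bounded_linear (\<lambda>z. inverse (snd p - fst p) *\<^sub>R (T (snd p) z - T (fst p) z))"
      by (intro bounded_linear_compose[OF bounded_linear_scaleR_right] bounded_linear_sub lin) auto
  next
    fix z
    obtain B where B: "\<forall>s\<in>{0..\<tau>}. \<forall>t\<in>{0..\<tau>}. norm (T t z - T s z) \<le> B * \<bar>t - s\<bar>"
      using C1_halfline_lipschitz[OF C1] by blast
    \<comment> \<open>The constant \<open>B\<close> may be negative if the interval has at most one
      point, hence the absolute value.\<close>
    have "norm (inverse (t - s) *\<^sub>R (T t z - T s z)) \<le> \<bar>B\<bar>" if "s \<in> {0..\<tau>}" "t \<in> {0..\<tau>}" for s t
    proof (cases "s = t")
      case False
      have "norm (T t z - T s z) \<le> \<bar>B\<bar> * \<bar>t - s\<bar>"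
        using B that by (meson abs_ge_self abs_ge_zero mult_right_mono order_trans)
      then have "\<bar>inverse (t - s)\<bar> * norm (T t z - T s z) \<le> \<bar>inverse (t - s)\<bar> * (\<bar>B\<bar> * \<bar>t - s\<bar>)"
        by (intro mult_left_mono) auto
      also have "\<dots> = \<bar>B\<bar>" using False by (simp add: field_simps)
      finally show ?thesis by (simp only: norm_scaleR real_norm_def)
    qed simp
    then show "\<exists>B. \<forall>p\<in>{0..\<tau>} \<times> {0..\<tau>}.
        norm (inverse (snd p - fst p) *\<^sub>R (T (snd p) z - T (fst p) z)) \<le> B"
      by (intro exI[of _ "\<bar>B\<bar>"]) auto
  qed
  then obtain C where C: "C \<ge> 0"
    "\<And>s t z. s \<in> {0..\<tau>} \<Longrightarrow> t \<in> {0..\<tau>} \<Longrightarrow> norm (inverse (t - s) *\<^sub>R (T t z - T s z)) \<le> C * norm z"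
    by fastforce
  have "norm (T t z - T s z) \<le> C * \<bar>t - s\<bar> * norm z" if "s \<in> {0..\<tau>}" "t \<in> {0..\<tau>}" for s t z

  proof (cases "s = t")
    case False
    have "\<bar>t - s\<bar> * norm (inverse (t - s) *\<^sub>R (T t z - T s z)) \<le> \<bar>t - s\<bar> * (C * norm z)"
      using C(2)[OF that] by (intro mult_left_mono) auto
    moreover have "\<bar>t - s\<bar> * norm (inverse (t - s) *\<^sub>R (T t z - T s z)) = norm (T t z - T s z)"
      using False unfolding norm_scaleR by (simp add: field_simps)
    ultimately show ?thesis by (simp only: mult_ac)
  qed simp
  with C(1) show ?thesis by blast
qed

text \<open>The Lipschitz estimate is measured from time 0, where the operator is bounded. The
  constant is strictly positive so that it can serve as a divisor in the coercivity
  estimate.\<close>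

lemma C1_family_bounded:
  fixes T :: "real \<Rightarrow> 'a::{real_normed_vector,complete_space} \<Rightarrow> 'b::real_normed_vector"
  assumes lin: "\<And>t. t \<ge> 0 \<Longrightarrow> bounded_linear (T t)"
    and C1: "\<And>z. C1_halfline (\<lambda>t. T t z)"
  shows "\<exists>C>0. \<forall>t\<in>{0..\<tau>}. \<forall>z. norm (T t z) \<le> C * norm z"
proof -
  obtain L where L: "L \<ge> 0"
    "\<forall>s\<in>{0..\<tau>}. \<forall>t\<in>{0..\<tau>}. \<forall>z. norm (T t z - T s z) \<le> L * \<bar>t - s\<bar> * norm z"
    using C1_family_lipschitz[OF assms] by blast
  obtain B where B: "\<And>z. norm (T 0 z) \<le> norm z * B" "B > 0"
    using bounded_linear.pos_bounded[OF lin[of 0]] by auto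
  \<comment> \<open>Taking \<open>\<bar>\<tau>\<bar>\<close> keeps the constant positive also for
    negative \<open>\<tau>\<close>, when the interval is empty.\<close>
  have "norm (T t z) \<le> (B + L * \<bar>\<tau>\<bar>) * norm z" if t: "t \<in> {0..\<tau>}" for t z
  proof -
    have "norm (T t z) \<le> norm (T 0 z) + norm (T t z - T 0 z)"
      by (metis add.commute norm_triangle_sub)
    also have "norm (T t z - T 0 z) \<le> L * \<bar>t - 0\<bar> * norm z"
      using L(2) t by (intro L(2)[rule_format]) auto
    also have "\<dots> \<le> L * \<bar>\<tau>\<bar> * norm z"
      using t L(1) by (intro mult_right_mono mult_left_mono) auto
    finally show ?thesis using B(1)[of z] by (simp add: algebra_simps)
  qed
  then show ?thesis using B(2) L(1) by (intro exI[of _ "B + L * \<bar>\<tau>\<bar>"]) (auto intro: add_pos_nonneg)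
qed

section \<open>Product rule and derivative bounds\<close>

text \<open>The remainder of \<open>T s (x s)\<close> splits into three: the remainder of
  \<open>T\<close> at the fixed vector \<open>x t\<close>, the operator \<open>T s\<close> applied
  to the remainder of \<open>x\<close>, and the variation of \<open>T\<close> at \<open>x'\<close>.
  They vanish by strong differentiability, by the uniform bound \<open>C\<close>, and by strong
  continuity at \<open>x'\<close> respectively.\<close>

lemma has_vector_derivative_operator_apply:
  fixes T :: "real \<Rightarrow> 'a::real_normed_vector \<Rightarrow> 'b::real_normed_vector"
  assumes t: "t \<in> I"
    and lin: "\<And>s. s \<in> I \<Longrightarrow> bounded_linear (T s)"
    and bdd: "\<And>s z. s \<in> I \<Longrightarrow> norm (T s z) \<le> C * norm z"
    and T: "((\<lambda>s. T s (x t)) has_vector_derivative p) (at t within I)"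
    and x: "(x has_vector_derivative x') (at t within I)"
    and cont: "((\<lambda>s. T s x') \<longlongrightarrow> T t x') (at t within I)"
  shows "((\<lambda>s. T s (x s)) has_vector_derivative p + T t x') (at t within I)"
proof -
  let ?q = "\<lambda>s. 1 / norm (s - t)"
  let ?r1 = "\<lambda>s. ?q s *\<^sub>R (T s (x t) - (T t (x t) + (s - t) *\<^sub>R p))"
  let ?r2 = "\<lambda>s. ?q s *\<^sub>R (x s - (x t + (s - t) *\<^sub>R x'))"
  let ?r3 = "\<lambda>s. (?q s * (s - t)) *\<^sub>R (T s x' - T t x')"
  have r1: "(?r1 \<longlongrightarrow> 0) (at t within I)" and r2: "(?r2 \<longlongrightarrow> 0) (at t within I)"
    using T x by (auto simp: has_vector_derivative_def has_derivative_within)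
  have ev: "\<forall>\<^sub>F s in at t within I. s \<in> I" by (auto simp: eventually_at_filter)
  have Tr2: "((\<lambda>s. T s (?r2 s)) \<longlongrightarrow> 0) (at t within I)"
  proof (rule Lim_null_comparison)
    show "\<forall>\<^sub>F s in at t within I. norm (T s (?r2 s)) \<le> C * norm (?r2 s)"
      using ev by eventually_elim (rule bdd)
    show "((\<lambda>s. C * norm (?r2 s)) \<longlongrightarrow> 0) (at t within I)"
      using tendsto_mult_right_zero[OF tendsto_norm_zero[OF r2]] .
  qed
  \<comment> \<open>The scalar factor is the sign of \<open>s - t\<close>, and 0 at
    \<open>s = t\<close> because of division by zero, so it has modulus at most 1.\<close>
  have r3: "(?r3 \<longlongrightarrow> 0) (at t within I)"
  proof (rule Lim_null_comparison)
    show "\<forall>\<^sub>F s in at t within I. norm (?r3 s) \<le> norm (T s x' - T t x')"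
      by (intro always_eventually allI) (auto simp: abs_mult)
    show "((\<lambda>s. norm (T s x' - T t x')) \<longlongrightarrow> 0) (at t within I)"
      using tendsto_norm_zero[OF Lim_null[THEN iffD1, OF cont]] .
  qed
  have "((\<lambda>s. ?r1 s + T s (?r2 s) + ?r3 s) \<longlongrightarrow> 0) (at t within I)"
    using tendsto_add[OF tendsto_add[OF r1 Tr2] r3] by simp
  moreover have "\<forall>\<^sub>F s in at t within I. ?r1 s + T s (?r2 s) + ?r3 s =
      ?q s *\<^sub>R (T s (x s) - (T t (x t) + (s - t) *\<^sub>R (p + T t x')))"
    using ev
  proof eventually_elim
    case (elim s)
    interpret bounded_linear "T s" by (rule lin[OF elim])
    have "T s (?r2 s) = ?q s *\<^sub>R (T s (x s) - (T s (x t) + (s - t) *\<^sub>R T s x'))"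
      by (simp add: diff add scaleR)
    then show ?case by (simp add: scaleR_add_right scaleR_diff_right)
  qed
  ultimately have "((\<lambda>s. ?q s *\<^sub>R (T s (x s) - (T t (x t) + (s - t) *\<^sub>R (p + T t x')))) \<longlongrightarrow> 0) (at t within I)"
    by (simp add: tendsto_cong)
  then show ?thesis
    by (auto simp: has_vector_derivative_def has_derivative_within bounded_linear_scaleR_left)
qed

text \<open>Every difference quotient at \<open>t\<close> has norm at most \<open>L\<close>, and
  \<open>p\<close> is their limit. The one-sided case is included, since \<open>t\<close> may be an
  endpoint.\<close>

lemma norm_vector_derivative_le_lipschitz:
  assumes t: "t \<in> {a..b}" "a < b"
    and der: "(f has_vector_derivative p) (at t within {a..b})"
    and lip: "\<And>s. s \<in> {a..b} \<Longrightarrow> norm (f s - f t) \<le> L * \<bar>s - t\<bar>"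
  shows "norm p \<le> L"
proof (rule field_le_epsilon)
  fix e :: real assume e: "e > 0"
  obtain d where d: "d > 0"
    "\<And>s. s \<in> {a..b} \<Longrightarrow> norm (s - t) < d \<Longrightarrow> norm (f s - f t - (s - t) *\<^sub>R p) \<le> e * norm (s - t)"
    using der e unfolding has_vector_derivative_def has_derivative_within_alt by metis
  \<comment> \<open>Here \<open>a < b\<close> matters: it supplies a point \<open>s\<close>
    different from \<open>t\<close>, so that \<open>\<bar>s - t\<bar>\<close> can be
    cancelled.\<close>
  have "t islimpt {a..b}" using t by simp
  then obtain s where s: "s \<in> {a..b}" "s \<noteq> t" "dist s t < d"
    using d(1) by (auto simp: islimpt_approachable)
  have "norm ((s - t) *\<^sub>R p) \<le> norm (f s - f t) + norm (f s - f t - (s - t) *\<^sub>R p)"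
    using norm_triangle_ineq4[of "f s - f t" "f s - f t - (s - t) *\<^sub>R p"] by simp
  also have "\<dots> \<le> L * \<bar>s - t\<bar> + e * \<bar>s - t\<bar>"
    using lip[OF s(1)] d(2)[OF s(1)] s(3) unfolding dist_norm real_norm_def by (intro add_mono) simp_all
  finally have "norm p * \<bar>s - t\<bar> \<le> (L + e) * \<bar>s - t\<bar>" by (simp add: distrib_right mult.commute)
  then show "norm p \<le> L + e" using s(2) by simp
qed

section \<open>Gronwall inequality and energy estimate\<close>

text \<open>The weighted function \<open>exp (- (M * t)) * \<phi> t\<close> has nonpositive
  derivative, so by the mean value theorem it stays below its initial value.\<close>

lemma gronwall_nonpos:
  fixes \<phi> :: "real \<Rightarrow> real"
  assumes "0 \<le> \<tau>"
    and der: "\<And>t. t \<in> {0..\<tau>} \<Longrightarrow> (\<phi> has_real_derivative \<phi>' t) (at t within {0..\<tau>})"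
    and le: "\<And>t. t \<in> {0..\<tau>} \<Longrightarrow> \<phi>' t \<le> M * \<phi> t"
    and "\<phi> 0 \<le> 0"
  shows "\<phi> \<tau> \<le> 0"
proof -
  let ?g = "\<lambda>t. exp (- (M * t)) * \<phi> t"
  let ?g' = "\<lambda>t. exp (- (M * t)) * (\<phi>' t - M * \<phi> t)"
  have "(?g has_derivative (\<lambda>h. ?g' t * h)) (at t within {0..\<tau>})" if "0 \<le> t" "t \<le> \<tau>" for t
  proof -
    have "(?g has_real_derivative ?g' t) (at t within {0..\<tau>})"
      using that by (auto intro!: derivative_eq_intros der simp: algebra_simps)
    then show ?thesis by (simp add: has_field_derivative_def)
  qed
  from mvt_very_simple[OF \<open>0 \<le> \<tau>\<close> this] obtain t where
    t: "t \<in> {0..\<tau>}" "?g \<tau> - ?g 0 = ?g' t * (\<tau> - 0)"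
    by blast
  have "?g' t * (\<tau> - 0) \<le> 0"
    using le[OF t(1)] \<open>0 \<le> \<tau>\<close> by (intro mult_nonpos_nonneg mult_nonneg_nonpos) auto
  with t(2) \<open>\<phi> 0 \<le> 0\<close> have "exp (- (M * \<tau>)) * \<phi> \<tau> \<le> 0" by simp
  then show ?thesis by (simp add: mult_le_0_iff)
qed

text \<open>A quadratic inequality in \<open>s\<close> gives the lower bound of a positive operator
  from the bound \<open>C\<close> of its inverse, without operator square roots. The choice
  \<open>s = 1 / C\<close> maximises the resulting coefficient
  \<open>2 * s - C * s * s\<close>.\<close>

lemma coercive_if_nonneg_bounded_inverse:
  fixes P Q :: "'x::real_inner \<Rightarrow> 'x"
  assumes "linear P"
    and sym: "\<And>x y. inner (P x) y = inner x (P y)"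
    and nonneg: "\<And>x. inner (P x) x \<ge> 0"
    and inv: "P (Q z) = z"
    and "norm (Q z) \<le> C * norm z" "C > 0"
  shows "(norm z)\<^sup>2 \<le> C * inner (P z) z"
proof -
  \<comment> \<open>expand \<open>\<langle>P w, w\<rangle> \<ge> 0\<close> for \<open>w = z - s Q z\<close>\<close>
  define s where "s = 1 / C"
  have s: "s > 0" "s * C = 1" using \<open>C > 0\<close> by (auto simp: s_def)
  have sq: "inner z z = (norm z)\<^sup>2" by (simp add: power2_norm_eq_inner)
  have "inner z (Q z) \<le> norm z * norm (Q z)" by (rule norm_cauchy_schwarz)
  also have "\<dots> \<le> norm z * (C * norm z)" using assms(5) by (intro mult_left_mono) auto
  finally have le: "inner z (Q z) \<le> C * (norm z)\<^sup>2" by (simp add: power2_eq_square mult_ac)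
  have "0 \<le> inner (P (z - s *\<^sub>R Q z)) (z - s *\<^sub>R Q z)" by (rule nonneg)
  also have "\<dots> = inner (P z) z - 2 * s * (norm z)\<^sup>2 + s * s * inner z (Q z)"
    using sym[of z "Q z"]
    by (simp add: linear_diff[OF \<open>linear P\<close>] linear_scale[OF \<open>linear P\<close>] inv sq
        inner_diff_left inner_diff_right algebra_simps)
  also have "s * s * inner z (Q z) \<le> s * s * (C * (norm z)\<^sup>2)"
    using le s by (intro mult_left_mono) auto
  also have "s * s * (C * (norm z)\<^sup>2) = (s * C) * s * (norm z)\<^sup>2" by (simp only: mult_ac)
  finally have "s * (norm z)\<^sup>2 \<le> inner (P z) z" using s by simp
  then have "C * (s * (norm z)\<^sup>2) \<le> C * inner (P z) z"
    using \<open>C > 0\<close> by (intro mult_left_mono) auto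
  then show ?thesis using s by (simp add: mult.assoc[symmetric] mult.commute)
qed

text \<open>The difference \<open>d' t - G t (d t)\<close> stands for the contribution of the node,
  which cannot increase the energy. What remains in the energy derivative comes from the time
  dependence of \<open>P\<close> and from \<open>G\<close>, and both are quadratic in
  \<open>d t\<close>.\<close>

lemma dissipative_evolution_unique:
  fixes P Q G :: "real \<Rightarrow> 'x::{real_inner,complete_space} \<Rightarrow> 'x"
  assumes P: "\<And>t. t \<ge> 0 \<Longrightarrow> bounded_linear (P t)" "\<And>z. C1_halfline (\<lambda>t. P t z)"
    and Q: "\<And>t. t \<ge> 0 \<Longrightarrow> bounded_linear (Q t)" "\<And>z. C1_halfline (\<lambda>t. Q t z)"
    and G: "\<And>t. t \<ge> 0 \<Longrightarrow> bounded_linear (G t)" "\<And>z. C1_halfline (\<lambda>t. G t z)"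
    and inv: "\<And>t z. t \<ge> 0 \<Longrightarrow> P t (Q t z) = z"
    and sym: "\<And>t x y. t \<ge> 0 \<Longrightarrow> inner (P t x) y = inner x (P t y)"
    and nonneg: "\<And>t x. t \<ge> 0 \<Longrightarrow> inner (P t x) x \<ge> 0"
    and d: "\<And>t. t \<ge> 0 \<Longrightarrow> (d has_vector_derivative d' t) (at t within {0..})"
    and diss: "\<And>t. t \<ge> 0 \<Longrightarrow> inner (d' t - G t (d t)) (P t (d t)) \<le> 0"
    and "d 0 = 0" and "\<tau> \<ge> 0"
  shows "d \<tau> = 0"
proof (cases "\<tau> = 0")
  \<comment> \<open>A nondegenerate interval is needed for the Lipschitz constant to bound the
    derivative of \<open>P\<close>: on a single point derivatives are undetermined.\<close>
  case False
  with \<open>\<tau> \<ge> 0\<close> have \<tau>: "0 < \<tau>" by simp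
  obtain L where L: "L \<ge> 0"
    "\<forall>s\<in>{0..\<tau>}. \<forall>t\<in>{0..\<tau>}. \<forall>z. norm (P t z - P s z) \<le> L * \<bar>t - s\<bar> * norm z"
    using C1_family_lipschitz[OF P] by blast
  obtain CP where CP: "CP > 0" "\<forall>t\<in>{0..\<tau>}. \<forall>z. norm (P t z) \<le> CP * norm z"
    using C1_family_bounded[OF P] by blast
  obtain CQ where CQ: "CQ > 0" "\<forall>t\<in>{0..\<tau>}. \<forall>z. norm (Q t z) \<le> CQ * norm z"
    using C1_family_bounded[OF Q] by blast
  obtain CG where CG: "CG > 0" "\<forall>t\<in>{0..\<tau>}. \<forall>z. norm (G t z) \<le> CG * norm z"
    using C1_family_bounded[OF G] by blast
  \<comment> \<open>The derivative is chosen separately for each vector \<open>z\<close>, with no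
    linearity or boundedness in \<open>z\<close> built in; its bound comes from the Lipschitz
    constant \<open>L\<close>.\<close>
  have "\<forall>z. \<exists>g. \<forall>t\<ge>0. ((\<lambda>s. P s z) has_vector_derivative g t) (at t within {0..})"
    using P(2) unfolding C1_halfline_def by blast
  then obtain P' where
    "\<forall>z. \<forall>t\<ge>0. ((\<lambda>s. P s z) has_vector_derivative P' z t) (at t within {0..})"
    by (rule choice[THEN exE])
  then have P': "((\<lambda>s. P s z) has_vector_derivative P' z t) (at t within {0..})" if "t \<ge> 0" for t z
    using that by blast
  let ?\<phi> = "\<lambda>t. inner (P t (d t)) (d t)"
  \<comment> \<open>Symmetry of \<open>P t\<close> merges the two terms containing
    \<open>d' t\<close> into one with factor 2.\<close>
  let ?\<phi>' = "\<lambda>t. inner (P' (d t) t) (d t) + 2 * inner (d' t) (P t (d t))"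
  have coercive: "(norm (d t))\<^sup>2 \<le> CQ * ?\<phi> t" if "t \<in> {0..\<tau>}" for t
  proof (rule coercive_if_nonneg_bounded_inverse[where Q = "Q t"])
    show "linear (P t)" using that by (auto intro: bounded_linear.linear P(1))
    show "inner (P t x) y = inner x (P t y)" "inner (P t x) x \<ge> 0" "P t (Q t (d t)) = d t" for x y
      using that sym[of t x y] nonneg[of t x] inv[of t "d t"] by simp_all
  qed (use that CQ in auto)
  \<comment> \<open>In the Gronwall constant, \<open>L\<close> bounds the derivative of
    \<open>P\<close>, the product \<open>CG * CP\<close> bounds the pairing of \<open>G d\<close>
    with \<open>P d\<close>, and \<open>CQ\<close> converts the squared norm into energy.\<close>
  have "?\<phi> \<tau> \<le> 0"
  proof (rule gronwall_nonpos[where \<phi> = ?\<phi> and \<phi>' = ?\<phi>' and M = "(L + 2 * CG * CP) * CQ"])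
    fix t assume t: "t \<in> {0..\<tau>}"
    have sub: "{0..\<tau>} \<subseteq> {0..}" by auto
    have P't: "((\<lambda>s. P s z) has_vector_derivative P' z t) (at t within {0..\<tau>})" for z
      using has_vector_derivative_within_subset[OF P' sub] t by simp
    have dt: "(d has_vector_derivative d' t) (at t within {0..\<tau>})"
      using has_vector_derivative_within_subset[OF d sub] t by simp
    have "((\<lambda>s. P s (d s)) has_vector_derivative P' (d t) t + P t (d' t)) (at t within {0..\<tau>})"
    proof (rule has_vector_derivative_operator_apply[OF t _ CP(2)[rule_format] P't dt])
      show "((\<lambda>s. P s (d' t)) \<longlongrightarrow> P t (d' t)) (at t within {0..\<tau>})"
        using has_vector_derivative_continuous[OF P't] by (simp add: continuous_within)
    qed (auto intro: P)
    from bounded_bilinear.has_vector_derivative[OF bounded_bilinear_inner this dt]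
    have "(?\<phi> has_vector_derivative
        inner (P t (d t)) (d' t) + inner (P' (d t) t + P t (d' t)) (d t)) (at t within {0..\<tau>})" .
    moreover have "inner (P t (d t)) (d' t) + inner (P' (d t) t + P t (d' t)) (d t) = ?\<phi>' t"
      using t sym[of t "d' t" "d t"] inner_commute[of "P t (d t)" "d' t"]
      by (simp add: inner_add_left)
    ultimately have "(?\<phi> has_vector_derivative ?\<phi>' t) (at t within {0..\<tau>})"
      by simp
    then show "(?\<phi> has_real_derivative ?\<phi>' t) (at t within {0..\<tau>})"
      by (simp add: has_real_derivative_iff_has_vector_derivative)
    have "norm (P' (d t) t) \<le> L * norm (d t)"
    proof (rule norm_vector_derivative_le_lipschitz[OF t \<tau> P't])
      show "norm (P s (d t) - P t (d t)) \<le> L * norm (d t) * \<bar>s - t\<bar>" if "s \<in> {0..\<tau>}" for s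
        using L(2)[rule_format, OF t that, of "d t"] by (simp add: mult_ac)
    qed
    then have "inner (P' (d t) t) (d t) \<le> L * norm (d t) * norm (d t)"
      by (intro order_trans[OF norm_cauchy_schwarz] mult_right_mono) auto
    moreover have "inner (G t (d t)) (P t (d t)) \<le> (CG * norm (d t)) * (CP * norm (d t))"
      using CG CP t by (intro order_trans[OF norm_cauchy_schwarz] mult_mono) auto
    then have "inner (d' t) (P t (d t)) \<le> (CG * norm (d t)) * (CP * norm (d t))"
      using diss[of t] t by (simp add: inner_diff_left)
    ultimately have "?\<phi>' t \<le> (L + 2 * CG * CP) * (norm (d t))\<^sup>2"
      by (simp add: algebra_simps power2_eq_square)
    also have "\<dots> \<le> (L + 2 * CG * CP) * (CQ * ?\<phi> t)"
      using coercive[OF t] L(1) CG(1) CP(1) by (intro mult_left_mono) auto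
    finally show "?\<phi>' t \<le> (L + 2 * CG * CP) * CQ * ?\<phi> t" by (simp add: mult.assoc)
  qed (use \<tau> \<open>d 0 = 0\<close> in auto)
  then have "CQ * ?\<phi> \<tau> \<le> 0" using CQ(1) by (simp add: mult_le_0_iff)
  then have "(norm (d \<tau>))\<^sup>2 \<le> 0"
    using \<tau> by (intro order_trans[OF coercive]) auto
  then show ?thesis
    by simp
qed (use \<open>d 0 = 0\<close> in simp)

section \<open>Square integrable and H1 functions\<close>

lemma strongly_measurable_add:
  fixes f g :: "'t \<Rightarrow> 'a::real_normed_vector"
  assumes "strongly_measurable M f" "strongly_measurable M g"
  shows "strongly_measurable M (\<lambda>t. f t + g t)"
proof -
  obtain r s where "\<forall>n::nat. simple_function M (r n)" "AE t in M. (\<lambda>n. r n t) \<longlonglongrightarrow> f t"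
    "\<forall>n::nat. simple_function M (s n)" "AE t in M. (\<lambda>n. s n t) \<longlonglongrightarrow> g t"
    using assms by (auto simp: strongly_measurable_def)
  moreover from this(2,4) have "AE t in M. (\<lambda>n. r n t + s n t) \<longlonglongrightarrow> f t + g t"
    by eventually_elim (rule tendsto_add)
  ultimately show ?thesis
    unfolding strongly_measurable_def
    by (intro exI[of _ "\<lambda>n t. r n t + s n t"]) (auto intro: simple_function_compose2)
qed

lemma strongly_measurable_bounded_linear:
  assumes "strongly_measurable M f" "bounded_linear h"
  shows "strongly_measurable M (\<lambda>t. h (f t))"
proof -
  obtain s where "\<forall>n::nat. simple_function M (s n)" "AE t in M. (\<lambda>n. s n t) \<longlonglongrightarrow> f t"
    using assms by (auto simp: strongly_measurable_def)
  moreover from this(2) have "AE t in M. (\<lambda>n. h (s n t)) \<longlonglongrightarrow> h (f t)"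
    by eventually_elim (rule bounded_linear.tendsto[OF assms(2)])
  ultimately show ?thesis
    unfolding strongly_measurable_def
    by (intro exI[of _ "\<lambda>n t. h (s n t)"]) (auto intro: simple_function_compose1)
qed

text \<open>An almost everywhere limit of simple functions need not be measurable over a general
  \<open>M\<close>. The lower limit of the squared norms of the approximants is measurable and
  agrees with the squared norm almost everywhere, which makes the linearity of the nonnegative
  integral available.\<close>

lemma strongly_measurable_norm_version:
  fixes f :: "'t \<Rightarrow> 'a::real_normed_vector"
  assumes "strongly_measurable M f"
  obtains h where "h \<in> borel_measurable M" "AE t in M. ennreal ((norm (f t))\<^sup>2) = h t"
proof -
  obtain s where s: "\<And>n::nat. simple_function M (s n)" "AE t in M. (\<lambda>n. s n t) \<longlonglongrightarrow> f t"
    using assms by (auto simp: strongly_measurable_def)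
  let ?h = "\<lambda>t. liminf (\<lambda>n. ennreal ((norm (s n t))\<^sup>2))"
  have "?h \<in> borel_measurable M"
    using s(1) by (intro borel_measurable_liminf borel_measurable_simple_function
        simple_function_compose1[where g = "\<lambda>x. ennreal ((norm x)\<^sup>2)"])
  moreover have "AE t in M. ennreal ((norm (f t))\<^sup>2) = ?h t"
    using s(2)
  proof eventually_elim
    case (elim t)
    have "(\<lambda>n. ennreal ((norm (s n t))\<^sup>2)) \<longlonglongrightarrow> ennreal ((norm (f t))\<^sup>2)"
      using elim by (intro tendsto_ennrealI tendsto_power tendsto_norm)
    then show ?case using lim_imp_Liminf[OF sequentially_bot] by metis
  qed
  ultimately show thesis by (rule that)
qed

text \<open>The bound \<open>2 * (norm x)\<^sup>2 + 2 * (norm y)\<^sup>2\<close> for the squared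
  norm of a sum is integrated with the measurable versions in place of the squared norms.\<close>

lemma nn_integral_norm_add_finite:
  fixes f g :: "'t \<Rightarrow> 'a::real_normed_vector"
  assumes f: "strongly_measurable M f" "(\<integral>\<^sup>+t. ennreal ((norm (f t))\<^sup>2) \<partial>M) < \<infinity>"
    and g: "strongly_measurable M g" "(\<integral>\<^sup>+t. ennreal ((norm (g t))\<^sup>2) \<partial>M) < \<infinity>"
  shows "(\<integral>\<^sup>+t. ennreal ((norm (f t + g t))\<^sup>2) \<partial>M) < \<infinity>"
proof -
  obtain hf where hf: "hf \<in> borel_measurable M" "AE t in M. ennreal ((norm (f t))\<^sup>2) = hf t"
    using strongly_measurable_norm_version[OF f(1)] .
  obtain hg where hg: "hg \<in> borel_measurable M" "AE t in M. ennreal ((norm (g t))\<^sup>2) = hg t"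
    using strongly_measurable_norm_version[OF g(1)] .
  have le: "ennreal ((norm (x + y))\<^sup>2) \<le> 2 * ennreal ((norm x)\<^sup>2) + 2 * ennreal ((norm y)\<^sup>2)" for x y :: 'a
  proof -
    have "(norm (x + y))\<^sup>2 \<le> (norm x + norm y)\<^sup>2"
      by (intro power_mono norm_triangle_ineq) auto
    also have "\<dots> \<le> 2 * (norm x)\<^sup>2 + 2 * (norm y)\<^sup>2"
      using zero_le_power2[of "norm x - norm y"] by (simp add: power2_eq_square algebra_simps)
    finally have "ennreal ((norm (x + y))\<^sup>2) \<le> ennreal (2 * (norm x)\<^sup>2 + 2 * (norm y)\<^sup>2)"
      by (rule ennreal_leI)
    then show ?thesis by (simp add: ennreal_plus ennreal_mult)
  qed
  have "AE t in M. ennreal ((norm (f t + g t))\<^sup>2) \<le> 2 * hf t + 2 * hg t"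
    using hf(2) hg(2) by eventually_elim (metis le)
  then have "(\<integral>\<^sup>+t. ennreal ((norm (f t + g t))\<^sup>2) \<partial>M) \<le> (\<integral>\<^sup>+t. 2 * hf t + 2 * hg t \<partial>M)"
    by (rule nn_integral_mono_AE)
  also have "\<dots> = 2 * (\<integral>\<^sup>+t. hf t \<partial>M) + 2 * (\<integral>\<^sup>+t. hg t \<partial>M)"
    using hf(1) hg(1) by (simp add: nn_integral_add nn_integral_cmult)
  also have "\<dots> < \<infinity>"
    using f(2) g(2) nn_integral_cong_AE[OF hf(2)] nn_integral_cong_AE[OF hg(2)]
    by (simp add: ennreal_mult_less_top)
  finally show ?thesis .
qed

lemma L2_on_add: "L2_on I f \<Longrightarrow> L2_on I g \<Longrightarrow> L2_on I (\<lambda>t. f t + g t)"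
  unfolding L2_on_def using strongly_measurable_add nn_integral_norm_add_finite by blast

lemma L2_on_bounded_linear:
  assumes "L2_on I f" "bounded_linear h"
  shows "L2_on I (\<lambda>t. h (f t))"
proof -
  obtain B where B: "\<And>x. norm (h x) \<le> norm x * B" "B > 0"
    using bounded_linear.pos_bounded[OF assms(2)] by auto
  obtain k where k: "k \<in> borel_measurable (lebesgue_on I)"
    "AE t in lebesgue_on I. ennreal ((norm (f t))\<^sup>2) = k t"
    using strongly_measurable_norm_version assms(1) unfolding L2_on_def by blast
  have le: "ennreal ((norm (h x))\<^sup>2) \<le> ennreal (B\<^sup>2) * ennreal ((norm x)\<^sup>2)" for x
    using power_mono[OF B(1)[of x], of 2]
    by (simp add: power_mult_distrib mult.commute flip: ennreal_mult)
  have "AE t in lebesgue_on I. ennreal ((norm (h (f t)))\<^sup>2) \<le> ennreal (B\<^sup>2) * k t"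
    using k(2) by eventually_elim (metis le)
  then have "(\<integral>\<^sup>+t. ennreal ((norm (h (f t)))\<^sup>2) \<partial>lebesgue_on I)
      \<le> (\<integral>\<^sup>+t. ennreal (B\<^sup>2) * k t \<partial>lebesgue_on I)"
    by (rule nn_integral_mono_AE)
  also have "\<dots> = ennreal (B\<^sup>2) * (\<integral>\<^sup>+t. k t \<partial>lebesgue_on I)"
    using k(1) by (simp add: nn_integral_cmult)
  also have "\<dots> < \<infinity>"
    using assms(1) nn_integral_cong_AE[OF k(2)] by (simp add: L2_on_def ennreal_mult_less_top)
  finally show ?thesis
    using assms strongly_measurable_bounded_linear by (auto simp: L2_on_def)
qed

text \<open>Since \<open>enn2real\<close> also sends infinity to 0, a vanishing
  \<open>L2_norm_on\<close> alone is ambiguous; \<open>L2_on\<close> excludes the infinite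
  integral.\<close>

lemma L2_norm_on_eq_0_imp_AE:
  assumes "L2_on I f" "L2_norm_on I f = 0"
  shows "AE t in lebesgue_on I. f t = 0"
proof -
  obtain k where k: "k \<in> borel_measurable (lebesgue_on I)"
    "AE t in lebesgue_on I. ennreal ((norm (f t))\<^sup>2) = k t"
    using strongly_measurable_norm_version assms(1) unfolding L2_on_def by blast
  have "(\<integral>\<^sup>+t. k t \<partial>lebesgue_on I) = 0"
    using assms nn_integral_cong_AE[OF k(2)]
    by (auto simp: L2_on_def L2_norm_on_def enn2real_eq_0_iff)
  then have "AE t in lebesgue_on I. k t = 0"
    using nn_integral_0_iff_AE[OF k(1)] by simp
  with k(2) show ?thesis by eventually_elim simp
qed

lemma L2_loc_add: "L2_loc f \<Longrightarrow> L2_loc g \<Longrightarrow> L2_loc (\<lambda>t. f t + g t)"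
  by (simp add: L2_loc_def L2_on_add)

lemma L2_loc_bounded_linear: "L2_loc f \<Longrightarrow> bounded_linear h \<Longrightarrow> L2_loc (\<lambda>t. h (f t))"
  by (simp add: L2_loc_def L2_on_bounded_linear)

lemma H1_loc_add:
  assumes "H1_loc f" "H1_loc g"
  shows "H1_loc (\<lambda>t. f t + g t)"
proof -
  obtain f' g' where "L2_loc f'" "\<forall>t\<ge>0. (f' has_integral (f t - f 0)) {0..t}"
    "L2_loc g'" "\<forall>t\<ge>0. (g' has_integral (g t - g 0)) {0..t}"
    using assms unfolding H1_loc_def by blast
  then show ?thesis
    unfolding H1_loc_def
    by (intro exI[of _ "\<lambda>t. f' t + g' t"]) (auto simp: L2_loc_add add_diff_add intro: has_integral_add)
qed

lemma H1_loc_bounded_linear: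
  assumes "H1_loc f" and h: "bounded_linear h"
  shows "H1_loc (\<lambda>t. h (f t))"
proof -
  obtain f' where "L2_loc f'" "\<forall>t\<ge>0. (f' has_integral (f t - f 0)) {0..t}"
    using assms unfolding H1_loc_def by blast
  then have "L2_loc (\<lambda>t. h (f' t))"
    "\<forall>t\<ge>0. ((\<lambda>t. h (f' t)) has_integral (h (f t) - h (f 0))) {0..t}"
    using has_integral_linear[OF _ h, of f'] bounded_linear.linear[OF h]
    by (simp_all add: L2_loc_bounded_linear h o_def flip: linear_diff)
  then show ?thesis
    unfolding H1_loc_def by blast
qed

section \<open>Pointwise identification of almost everywhere equal functions\<close>

text \<open>A nonzero value at \<open>t\<close> would persist on an interval of positive measure.
  The interval is taken to the right of \<open>t\<close>, so that it stays in the half-line even for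
  \<open>t = 0\<close>.\<close>

lemma continuous_AE_eq_0_halfline:
  fixes h :: "real \<Rightarrow> real"
  assumes cont: "continuous_on {0..} h" and ae: "AE t in lebesgue_on {0..}. h t = 0" and "t \<ge> 0"
  shows "h t = 0"
proof (rule ccontr)
  assume "h t \<noteq> 0"
  then obtain \<delta> where \<delta>: "\<delta> > 0" "\<And>s. s \<ge> 0 \<Longrightarrow> dist s t < \<delta> \<Longrightarrow> dist (h s) (h t) < \<bar>h t\<bar>"
    using cont \<open>t \<ge> 0\<close> unfolding continuous_on_iff by (metis atLeast_iff zero_less_abs_iff)
  have "AE s in lebesgue. s \<in> {0..} \<longrightarrow> h s = 0"
    using ae by (subst (asm) AE_restrict_space_iff) auto
  then have "AE s in lebesgue. s \<notin> {t<..<t+\<delta>}"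
  proof eventually_elim
    case (elim s)
    then show ?case using \<delta>(2)[of s] \<open>t \<ge> 0\<close> by (auto simp: dist_real_def)
  qed
  then have "emeasure lebesgue {t<..<t+\<delta>} = 0"
    using AE_iff_measurable[of "{t<..<t+\<delta>}" lebesgue "\<lambda>s. s \<notin> {t<..<t+\<delta>}"]
    by (simp add: greaterThanLessThan_def greaterThan_def lessThan_def Int_def)
  with \<open>\<delta> > 0\<close> show False by simp
qed

text \<open>
  The sort \<open>{real_inner, complete_space}\<close> is not contained in \<open>banach\<close>, which the continuity of
  indefinite integrals requires; weak continuity suffices to identify continuous representatives.
\<close>

lemma H1_loc_continuous_inner:
  fixes f :: "real \<Rightarrow> 'a::real_inner"
  assumes "H1_loc f"
  shows "continuous_on {0..} (\<lambda>t. inner (f t) v)"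
proof -
  obtain g where g: "\<And>t. t \<ge> 0 \<Longrightarrow> (g has_integral (f t - f 0)) {0..t}"
    using assms by (auto simp: H1_loc_def)
  have int: "((\<lambda>s. inner (g s) v) has_integral inner (f t - f 0) v) {0..t}" if "t \<ge> 0" for t
    using has_integral_linear[OF g[OF that] bounded_linear_inner_left] by (simp add: o_def)
  have "continuous_on {0..\<tau>} (\<lambda>t. inner (f t) v)" if "\<tau> \<ge> 0" for \<tau>
  proof -
    have "continuous_on {0..\<tau>} (\<lambda>t. inner (f 0) v + integral {0..t} (\<lambda>s. inner (g s) v))"
      using int[OF that] by (intro continuous_intros indefinite_integral_continuous_1) auto
    moreover have "inner (f 0) v + integral {0..t} (\<lambda>s. inner (g s) v) = inner (f t) v" if "t \<in> {0..\<tau>}" for t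
      using int[THEN integral_unique, of t] that by (simp add: inner_diff_left)
    ultimately show ?thesis by (rule continuous_on_eq)
  qed
  note cont = this
  show ?thesis
    unfolding continuous_on_eq_continuous_within
  proof
    fix t :: real assume t: "t \<in> {0..}"
    have "continuous (at t within {0..t+1}) (\<lambda>t. inner (f t) v)"
      using cont[of "t + 1"] t by (auto simp: continuous_on_eq_continuous_within)
    \<comment> \<open>Continuity passes from compact intervals to the half-line because it is local;
      the endpoint \<open>t + 1\<close> leaves room to the right of \<open>t\<close>.\<close>
    moreover have "at t within {0..t+1} = at t within {0..}"
      by (rule at_within_nhd[of _ "{..<t+1}"]) auto
    ultimately show "continuous (at t within {0..}) (\<lambda>t. inner (f t) v)" by simp
  qed
qed

text \<open>For fixed \<open>t\<close> the vector \<open>f t - g t\<close> itself serves as test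
  vector: the scalar function obtained is continuous and vanishes almost everywhere, and its value
  at \<open>t\<close> is the squared norm of that vector.\<close>

lemma H1_loc_ae_eq_imp_eq:
  fixes f g :: "real \<Rightarrow> 'a::real_inner"
  assumes "H1_loc f" "H1_loc g" and ae: "ae_eq f g" and "t \<ge> 0"
  shows "f t = g t"
proof -
  let ?v = "f t - g t"
  have "inner (f t) ?v - inner (g t) ?v = 0"
  proof (rule continuous_AE_eq_0_halfline[where h = "\<lambda>t. inner (f t) ?v - inner (g t) ?v"])
    show "continuous_on {0..} (\<lambda>t. inner (f t) ?v - inner (g t) ?v)"
      using assms by (intro continuous_on_diff H1_loc_continuous_inner)
    show "AE t in lebesgue_on {0..}. inner (f t) ?v - inner (g t) ?v = 0"
      using ae unfolding ae_eq_def by eventually_elim simp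
  qed (rule \<open>t \<ge> 0\<close>)
  then show ?thesis by (simp flip: inner_diff_left)
qed

section \<open>The effort signal as a limit\<close>

lemma ae_eq_imp_AE_interval:
  assumes "ae_eq f g"
  shows "AE t in lebesgue_on {0..\<tau>}. f t = g t"
proof -
  have "AE t in lebesgue. t \<in> {0..} \<longrightarrow> f t = g t"
    using assms unfolding ae_eq_def by (subst (asm) AE_restrict_space_iff) auto
  then have "AE t in lebesgue. t \<in> {0..\<tau>} \<longrightarrow> f t = g t"
    by eventually_elim auto
  then show ?thesis by (subst AE_restrict_space_iff) auto
qed

text \<open>Intervals with integer endpoints exhaust the half-line, and a countable union of null
  sets is null.\<close>

lemma ae_eq_if_AE_intervals:
  assumes "\<And>\<tau>. \<tau> \<ge> 0 \<Longrightarrow> AE t in lebesgue_on {0..\<tau>}. f t = g t"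
  shows "ae_eq f g"
proof -
  have "AE t in lebesgue. t \<in> {0..real n} \<longrightarrow> f t = g t" for n
    using assms[of "real n"] AE_restrict_space_iff[of "{0..real n}" lebesgue "\<lambda>t. f t = g t"] by simp
  then have "AE t in lebesgue. \<forall>n. t \<in> {0..real n} \<longrightarrow> f t = g t"
    by (simp only: AE_all_countable) blast
  then have "AE t in lebesgue. t \<in> {0..} \<longrightarrow> f t = g t"
    by eventually_elim (meson atLeastAtMost_iff atLeast_iff real_arch_simple)
  then show ?thesis unfolding ae_eq_def by (subst AE_restrict_space_iff) auto
qed

text \<open>Once \<open>t \<ge> \<tau>\<close>, the output identity of the mild solution turns the
  expression in the seminorm on \<open>{0..\<tau>}\<close> into \<open>u + y - w\<close> almost
  everywhere. The seminorm is thus eventually constant, and its limit 0 is its value.\<close>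

lemma mild_solution_effort_limit:
  assumes mild: "mild_solution \<Sigma> x0 u x y" and w: "L2_loc w"
    and lim: "\<And>\<tau>. \<tau> \<ge> 0 \<Longrightarrow> ((\<lambda>t. L2_norm_on {0..\<tau>}
      (\<lambda>s. output_map \<Sigma> t 0 x0 s + u s + io_map \<Sigma> t 0 (cut 0 t u) s - w s)) \<longlongrightarrow> 0) at_top"
  shows "ae_eq (\<lambda>t. u t + y t) w"
proof (rule ae_eq_if_AE_intervals)
  fix \<tau> :: real assume \<tau>: "\<tau> \<ge> 0"
  let ?h = "\<lambda>s. u s + y s - w s"
  have "\<forall>\<^sub>F t in at_top. L2_norm_on {0..\<tau>}
      (\<lambda>s. output_map \<Sigma> t 0 x0 s + u s + io_map \<Sigma> t 0 (cut 0 t u) s - w s) = L2_norm_on {0..\<tau>} ?h"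
    using eventually_ge_at_top[of \<tau>]
  proof eventually_elim
    case (elim t)
    have "ae_eq (cut 0 t y) (\<lambda>s. output_map \<Sigma> t 0 x0 s + io_map \<Sigma> t 0 (cut 0 t u) s)"
      using mild elim \<tau> by (simp add: mild_solution_def)
    then have "AE s in lebesgue_on {0..\<tau>}.
        cut 0 t y s = output_map \<Sigma> t 0 x0 s + io_map \<Sigma> t 0 (cut 0 t u) s"
      by (rule ae_eq_imp_AE_interval)
    moreover have "AE s in lebesgue_on {0..\<tau>}. s \<in> {0..\<tau>}"
      by (rule AE_I2) simp
    ultimately have "AE s in lebesgue_on {0..\<tau>}.
        output_map \<Sigma> t 0 x0 s + u s + io_map \<Sigma> t 0 (cut 0 t u) s - w s = ?h s"
    proof eventually_elim
      case (elim s)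
      then have "y s = output_map \<Sigma> t 0 x0 s + io_map \<Sigma> t 0 (cut 0 t u) s"
        using \<open>\<tau> \<le> t\<close> by (simp add: cut_def)
      then show ?case by simp
    qed
    then have "AE s in lebesgue_on {0..\<tau>}.
        ennreal ((norm (output_map \<Sigma> t 0 x0 s + u s + io_map \<Sigma> t 0 (cut 0 t u) s - w s))\<^sup>2) =
        ennreal ((norm (?h s))\<^sup>2)"
      by eventually_elim (simp only:)
    from nn_integral_cong_AE[OF this] show ?case by (simp add: L2_norm_on_def)
  qed
  then have "((\<lambda>t::real. L2_norm_on {0..\<tau>} ?h) \<longlongrightarrow> 0) at_top"
    using lim[OF \<tau>] by (simp add: tendsto_cong)
  then have "L2_norm_on {0..\<tau>} ?h = 0"
    by (simp add: tendsto_const_iff)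
  moreover have "L2_on {0..\<tau>} ?h"
  proof -
    have "L2_on {0..\<tau>} u" "L2_on {0..\<tau>} y" "L2_on {0..\<tau>} w"
      using mild w \<tau> by (simp_all add: mild_solution_def L2_loc_def)
    then have "L2_on {0..\<tau>} (\<lambda>s. u s + y s + - w s)"
      by (intro L2_on_add L2_on_bounded_linear[where h = uminus] bounded_linear_minus bounded_linear_ident)
    then show ?thesis by simp
  qed
  ultimately have "AE t in lebesgue_on {0..\<tau>}. ?h t = 0"
    by (intro L2_norm_on_eq_0_imp_AE)
  then show "AE t in lebesgue_on {0..\<tau>}. u t + y t = w t"
    by eventually_elim simp
qed

section \<open>Real structure of Hilbert spaces over \<open>K\<close>\<close>

text \<open>By polarization the real part of \<open>ip\<close> is determined by the norm, which
  \<open>ip\<close> shares with \<open>inner\<close>. Dissipativity and positivity can therefore be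
  used in the real inner product.\<close>

lemma hilbert_Re_ip:
  assumes "hilbert K H"
  shows "Re (ip H x y) = inner x y"
proof -
  have add: "ip H (x + y) z = ip H x z + ip H y z" and cnj: "ip H y x = cnj (ip H x y)"
    and norm: "ip H x x = complex_of_real ((norm x)\<^sup>2)" for x y z
    using assms unfolding hilbert_def by blast+
  have "ip H z (x + y) = ip H z x + ip H z y" for z
    by (metis add cnj complex_cnj_add)
  then have "ip H (x + y) (x + y) = ip H x x + ip H y y + (ip H x y + cnj (ip H x y))"
    using cnj[of y x] by (simp add: add)
  then have "Re (ip H (x + y) (x + y)) = Re (ip H x x) + Re (ip H y y) + 2 * Re (ip H x y)"
    by simp
  then show ?thesis by (simp add: norm power2_norm_eq_inner inner_simps inner_commute[of y x])
qed

lemma hilbert_scaleR: "hilbert K H \<Longrightarrow> sc H (complex_of_real r) x = r *\<^sub>R x"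
  unfolding hilbert_def by blast

lemma hilbert_sc_add: "hilbert K H \<Longrightarrow> a \<in> K \<Longrightarrow> b \<in> K \<Longrightarrow> sc H (a + b) x = sc H a x + sc H b x"
  unfolding hilbert_def by blast

lemma hilbert_sc_mult: "hilbert K H \<Longrightarrow> a \<in> K \<Longrightarrow> b \<in> K \<Longrightarrow> sc H (a * b) x = sc H a (sc H b x)"
  unfolding hilbert_def by blast

lemma hilbert_ip_self: "hilbert K H \<Longrightarrow> ip H x x = complex_of_real ((norm x)\<^sup>2)"
  unfolding hilbert_def by blast

text \<open>The spaces enter only through the law for real scalars, so that the result applies
  directly to \<open>prod_kspace\<close>.\<close>

lemma linear_op_real:
  assumes "linear_op K H L D T" "\<real> \<subseteq> K"
    and "\<And>r x. sc H (complex_of_real r) x = r *\<^sub>R x" "\<And>r x. sc L (complex_of_real r) x = r *\<^sub>R x"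
    and "x \<in> D"
  shows "r *\<^sub>R x \<in> D" "T (r *\<^sub>R x) = r *\<^sub>R T x"
    "y \<in> D \<Longrightarrow> x - y \<in> D" "y \<in> D \<Longrightarrow> T (x - y) = T x - T y"
proof -
  have sc: "r *\<^sub>R x \<in> D \<and> T (r *\<^sub>R x) = r *\<^sub>R T x" if "x \<in> D" for r x
  proof -
    have "complex_of_real r \<in> K" using assms(2) by auto
    with assms(1) that have "sc H (complex_of_real r) x \<in> D \<and>
        T (sc H (complex_of_real r) x) = sc L (complex_of_real r) (T x)"
      by (simp add: linear_op_def)
    then show ?thesis by (simp only: assms(3,4))
  qed
  show "r *\<^sub>R x \<in> D" "T (r *\<^sub>R x) = r *\<^sub>R T x"
    using sc[OF \<open>x \<in> D\<close>] by auto
  assume "y \<in> D"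
  then have "x + (-1) *\<^sub>R y \<in> D \<and> T (x + (-1) *\<^sub>R y) = T x + T ((-1) *\<^sub>R y)"
    using assms(1) \<open>x \<in> D\<close> sc[OF \<open>y \<in> D\<close>, of "-1"] unfolding linear_op_def by blast
  with sc[OF \<open>y \<in> D\<close>, of "-1"] show "x - y \<in> D" "T (x - y) = T x - T y"
    by simp_all
qed

lemma linear_op_UNIV_imp_linear:
  assumes "linear_op K H L UNIV T" "\<real> \<subseteq> K" "hilbert K H" "hilbert K L"
  shows "linear T"
proof (rule linearI)
  show "T (x + y) = T x + T y" for x y
    using assms(1) by (simp add: linear_op_def)
  show "T (r *\<^sub>R x) = r *\<^sub>R T x" for r x
    using linear_op_real(2)[OF assms(1,2)] assms(3,4) by (simp add: hilbert_scaleR)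
qed

lemma bounded_op_imp_bounded_linear:
  assumes "bounded_op K H L T" "\<real> \<subseteq> K" "hilbert K H" "hilbert K L"
  shows "bounded_linear T"
proof -
  obtain C where "\<And>x. norm (T x) \<le> C * norm x"
    using assms(1) by (auto simp: bounded_op_def)
  with linear_op_UNIV_imp_linear[of K H L T] assms show ?thesis
    by (auto simp: bounded_op_def bounded_linear_def bounded_linear_axioms_def mult.commute)
qed

text \<open>Real homogeneity holds because scalars commute, and sesquilinearity of \<open>ip\<close>
  gives \<open>norm (sc H a x) = cmod a * norm x\<close>. This lets multiplication by \<beta> and
  its conjugate act on H1 signals.\<close>

lemma hilbert_bounded_linear_sc:
  assumes H: "hilbert K H" and "\<real> \<subseteq> K" "a \<in> K"
  shows "bounded_linear (sc H a)"
proof (rule bounded_linear_intro)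
  show "sc H a (x + y) = sc H a x + sc H a y" for x y
    using H[unfolded hilbert_def, THEN conjunct1] \<open>a \<in> K\<close> by simp
  show "sc H a (r *\<^sub>R x) = r *\<^sub>R sc H a x" for r x
  proof -
    have "complex_of_real r \<in> K" using \<open>\<real> \<subseteq> K\<close> by auto
    with \<open>a \<in> K\<close> have "sc H a (sc H (complex_of_real r) x) = sc H (complex_of_real r) (sc H a x)"
      using hilbert_sc_mult[OF H, of a "complex_of_real r" x] hilbert_sc_mult[OF H, of "complex_of_real r" a x]
      by (metis mult.commute)
    then show ?thesis by (simp only: hilbert_scaleR[OF H])
  qed
  show "norm (sc H a x) \<le> norm x * cmod a" for x
  proof -
    have left: "\<And>y. ip H (sc H a x) y = a * ip H x y"
      and cnj: "\<And>x y. ip H y x = cnj (ip H x y)"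
      and norm: "\<And>x. ip H x x = complex_of_real ((norm x)\<^sup>2)"
      using H \<open>a \<in> K\<close> unfolding hilbert_def by blast+
    have "complex_of_real ((norm (sc H a x))\<^sup>2) = a * ip H x (sc H a x)"
      by (simp only: left flip: norm)
    also have "ip H x (sc H a x) = cnj (a * complex_of_real ((norm x)\<^sup>2))"
      by (subst cnj) (simp only: left norm)
    finally have "complex_of_real ((norm (sc H a x))\<^sup>2) = a * cnj a * complex_of_real ((norm x)\<^sup>2)"
      by simp
    also have "\<dots> = complex_of_real ((cmod a * norm x)\<^sup>2)"
      by (simp only: of_real_mult power_mult_distrib complex_norm_square)
    finally have "(norm (sc H a x))\<^sup>2 = (cmod a * norm x)\<^sup>2"
      by (simp only: of_real_eq_iff)
    then have "norm (sc H a x) = cmod a * norm x"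
      by (simp add: power2_eq_iff_nonneg)
    then show ?thesis by (simp add: mult.commute)
  qed
qed

text \<open>Preservation of \<open>ip\<close> makes \<open>U\<close> isometric, hence injective, and
  the inverse of a surjective linear isometry is again a linear isometry.\<close>

lemma unitary_op_bounded_linear_inv:
  assumes U: "unitary_op K H L U" and K: "\<real> \<subseteq> K" "hilbert K H" "hilbert K L"
  shows "bounded_linear (inv U)" "bij U"
proof -
  have lin: "linear U"
    using U K linear_op_UNIV_imp_linear by (auto simp: unitary_op_def)
  have "ip L (U x) (U x) = ip H x x" for x
    using U by (simp add: unitary_op_def)
  then have "complex_of_real ((norm (U x))\<^sup>2) = complex_of_real ((norm x)\<^sup>2)" for x
    by (simp only: hilbert_ip_self[OF K(2)] hilbert_ip_self[OF K(3)])
  then have norm: "norm (U x) = norm x" for x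
    by (simp only: of_real_eq_iff) (simp add: power2_eq_iff_nonneg)
  then have inj: "inj U"
    using lin by (metis linear_injective_0 norm_eq_zero)
  then show bij: "bij U" using U by (simp add: unitary_op_def bij_def)
  have UV: "U (inv U y) = y" for y using bij by (simp add: bij_is_surj surj_f_inv_f)
  show "bounded_linear (inv U)"
  proof (rule bounded_linear_intro)
    show "inv U (x + y) = inv U x + inv U y" for x y
      by (rule injD[OF inj]) (simp add: linear_add[OF lin] UV)
    show "inv U (r *\<^sub>R x) = r *\<^sub>R inv U x" for r x
      by (rule injD[OF inj]) (simp add: linear_scale[OF lin] UV)
    show "norm (inv U x) \<le> norm x * 1" for x
      using norm[of "inv U x"] UV by simp
  qed
qed

section \<open>From scattering solutions to effort solutions\<close>

text \<open>The map in \<open>cayley_injective\<close> lacks the factor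
  \<open>sqrt (2 * Re \<beta>)\<close> on the state; as that factor is nonzero, injectivity carries
  over and \<open>inv_into\<close> recovers the preimage.\<close>

lemma cayley_op_cayley_map:
  assumes "Re \<beta> > 0" "cayley_injective E \<psi> \<beta> D S" "(a, b) \<in> D"
  shows "cayley_op E \<psi> \<beta> D S (cayley_map E \<psi> \<beta> S (a, b)) =
    (sqrt (2 * Re \<beta>) *\<^sub>R fst (S (a, b)), sc E (cnj \<beta>) b - \<psi> (snd (S (a, b))))"
proof -
  have "inj_on (cayley_map E \<psi> \<beta> S) D"
    using assms(1,2) by (fastforce simp: inj_on_def cayley_injective_def cayley_map_def)
  from inv_into_f_f[OF this assms(3)] show ?thesis
    by (simp add: cayley_op_def Let_def)
qed

text \<open>Let \<open>c * c = 2 * Re \<beta>\<close> and let \<open>(a, b)\<close> be the preimage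
  of \<open>(P t (x t), u t)\<close> under the Cayley map. Then
  \<open>(P t (c *\<^sub>R x t), u t + y t)\<close> is \<open>c * c\<close> times
  \<open>(a, b)\<close>, and linearity of \<open>S\<close> transfers domain membership, dynamics and
  flow.\<close>

lemma classical_solution_of_cayley_op:
  assumes K: "\<real> \<subseteq> K" "\<beta> \<in> K" "cnj \<beta> \<in> K"
    and hilbert: "hilbert K X" "hilbert K E" "hilbert K F"
    and \<psi>: "unitary_op K F E \<psi>"
    and S: "linear_op K (prod_kspace X E) (prod_kspace X F) D S"
    and \<beta>: "Re \<beta> > 0" and inj: "cayley_injective E \<psi> \<beta> D S"
    and P: "\<And>t. t \<ge> 0 \<Longrightarrow> linear (P t)" "\<And>t. t \<ge> 0 \<Longrightarrow> bij (P t)"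
    and G: "\<And>t. t \<ge> 0 \<Longrightarrow> linear (G t)"
    and sol: "classical_solution (cayley_dom E \<psi> \<beta> D S) (cayley_op E \<psi> \<beta> D S) P G u x y"
  shows "classical_solution D S P G (\<lambda>t. u t + y t) (\<lambda>t. sqrt (2 * Re \<beta>) *\<^sub>R x t)
    (\<lambda>t. inv \<psi> (sc E (cnj \<beta>) (u t) - sc E \<beta> (y t)))"
proof -
  define c where "c = sqrt (2 * Re \<beta>)"
  have cc: "c * c = 2 * Re \<beta>" using \<beta> by (simp add: c_def)
  have lin\<beta>: "bounded_linear (sc E \<beta>)" "bounded_linear (sc E (cnj \<beta>))"
    using hilbert_bounded_linear_sc hilbert(2) K by blast+
  have lin\<psi>: "linear \<psi>"
    using \<psi> linear_op_UNIV_imp_linear[OF _ K(1) hilbert(3,2)] by (simp add: unitary_op_def)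
  have inv\<psi>: "bounded_linear (inv \<psi>)" "inj \<psi>"
    using unitary_op_bounded_linear_inv[OF \<psi> K(1) hilbert(3,2)] by (auto simp: bij_is_inj)
  have H1: "H1_loc u" "H1_loc y" and C1: "C1_halfline x"
    using sol by (auto simp: classical_solution_def)
  have sum: "sc E \<beta> v + sc E (cnj \<beta>) v = (c * c) *\<^sub>R v" for v
  proof -
    have "sc E \<beta> v + sc E (cnj \<beta>) v = sc E (\<beta> + cnj \<beta>) v"
      by (rule hilbert_sc_add[OF hilbert(2) K(2,3), symmetric])
    then show ?thesis
      by (simp only: complex_add_cnj hilbert_scaleR[OF hilbert(2)] cc)
  qed
  have comm: "sc E \<beta> (sc E (cnj \<beta>) v) = sc E (cnj \<beta>) (sc E \<beta> v)" for v
    by (metis hilbert_sc_mult[OF hilbert(2)] K(2,3) mult.commute)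
  have "H1_loc (\<lambda>t. u t + y t)"
    using H1 by (rule H1_loc_add)
  moreover have "H1_loc (\<lambda>t. inv \<psi> (sc E (cnj \<beta>) (u t) - sc E \<beta> (y t)))"
  proof -
    have "H1_loc (\<lambda>t. sc E (cnj \<beta>) (u t) + - sc E \<beta> (y t))"
      by (rule H1_loc_add[OF H1_loc_bounded_linear[OF H1(1) lin\<beta>(2)]
            H1_loc_bounded_linear[OF H1(2) bounded_linear_minus[OF lin\<beta>(1)]]])
    from H1_loc_bounded_linear[OF this inv\<psi>(1)] show ?thesis by simp
  qed
  moreover have "C1_halfline (\<lambda>t. c *\<^sub>R x t)"
  proof -
    obtain x' where "\<forall>t\<ge>0. (x has_vector_derivative x' t) (at t within {0..})" "continuous_on {0..} x'"
      using C1 by (auto simp: C1_halfline_def)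
    then show ?thesis
      unfolding C1_halfline_def
      by (intro exI[of _ "\<lambda>t. c *\<^sub>R x' t"])
        (auto intro!: continuous_intros bounded_linear.has_vector_derivative[OF bounded_linear_scaleR_right])
  qed
  moreover have "(P t (c *\<^sub>R x t), u t + y t) \<in> D \<and>
      ((\<lambda>t. c *\<^sub>R x t) has_vector_derivative
        (fst (S (P t (c *\<^sub>R x t), u t + y t)) + G t (inv (P t) (P t (c *\<^sub>R x t))))) (at t within {0..}) \<and>
      inv \<psi> (sc E (cnj \<beta>) (u t) - sc E \<beta> (y t)) = snd (S (P t (c *\<^sub>R x t), u t + y t))"
    if t: "t \<ge> 0" for t
  proof -
    have "(P t (x t), u t) \<in> cayley_dom E \<psi> \<beta> D S"
      using sol t by (simp add: classical_solution_def)
    then obtain a b where ab: "(a, b) \<in> D" "(P t (x t), u t) = cayley_map E \<psi> \<beta> S (a, b)"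
      by (auto simp: cayley_dom_def)
    define \<alpha> where "\<alpha> = fst (S (a, b))"
    define \<sigma> where "\<sigma> = \<psi> (snd (S (a, b)))"
    have op: "cayley_op E \<psi> \<beta> D S (P t (x t), u t) = (c *\<^sub>R \<alpha>, sc E (cnj \<beta>) b - \<sigma>)"
      using cayley_op_cayley_map[OF \<beta> inj ab(1)] ab(2) by (simp add: \<alpha>_def \<sigma>_def c_def)
    have Px: "P t (x t) = c *\<^sub>R a" and u: "u t = sc E \<beta> b + \<sigma>"
      using ab(2) by (simp_all add: cayley_map_def c_def \<sigma>_def)
    have y: "y t = sc E (cnj \<beta>) b - \<sigma>"
      using sol t op by (simp add: classical_solution_def)
    have der: "(x has_vector_derivative (c *\<^sub>R \<alpha> + G t (inv (P t) (P t (x t))))) (at t within {0..})"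
      using sol t op by (auto simp: classical_solution_def)
    have invP: "inv (P t) (P t z) = z" for z
      using P(2)[OF t] by (simp add: bij_is_inj)
    \<comment> \<open>The terms \<open>\<sigma>\<close> cancel in \<open>u t + y t\<close>, leaving
      \<open>b\<close> multiplied by \<open>\<beta> + cnj \<beta>\<close>.\<close>
    have w: "(P t (c *\<^sub>R x t), u t + y t) = (c * c) *\<^sub>R (a, b)"
      using sum[of b] by (simp add: linear_scale[OF P(1)[OF t]] Px u y)
    have Sw: "(c * c) *\<^sub>R (a, b) \<in> D" "S ((c * c) *\<^sub>R (a, b)) = (c * c) *\<^sub>R S (a, b)"
      using linear_op_real(1,2)[OF S K(1) _ _ ab(1)] hilbert
      by (auto simp: prod_kspace_def hilbert_scaleR)
    \<comment> \<open>Now the terms in \<open>b\<close> cancel, because multiplication by \<beta>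
      commutes with multiplication by its conjugate.\<close>
    have "sc E (cnj \<beta>) (u t) - sc E \<beta> (y t) = (c * c) *\<^sub>R \<sigma>"
      using sum[of \<sigma>] lin\<beta>[THEN bounded_linear.linear]
      by (simp add: u y linear_add linear_diff comm add.commute)
    also have "\<dots> = \<psi> ((c * c) *\<^sub>R snd (S (a, b)))"
      by (simp add: \<sigma>_def linear_scale[OF lin\<psi>])
    finally have "inv \<psi> (sc E (cnj \<beta>) (u t) - sc E \<beta> (y t)) = (c * c) *\<^sub>R snd (S (a, b))"
      using inv\<psi>(2) by simp
    moreover have "((\<lambda>t. c *\<^sub>R x t) has_vector_derivative (c * c) *\<^sub>R \<alpha> + G t (c *\<^sub>R x t)) (at t within {0..})"
      using bounded_linear.has_vector_derivative[OF bounded_linear_scaleR_right der, of c]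
      by (simp add: invP scaleR_add_right linear_scale[OF G[OF t]])
    ultimately show ?thesis
      using Sw by (simp only: w invP) (simp add: \<alpha>_def)
  qed
  ultimately show ?thesis
    unfolding classical_solution_def c_def by blast
qed

section \<open>Uniqueness for a prescribed effort\<close>

text \<open>For equal efforts the difference \<open>d\<close> of the states gives
  \<open>(P t d, 0)\<close> in \<open>D\<close>. The effort part of the dissipation inequality then
  pairs with 0, so only the pairing of the \<open>A&B\<close> row with \<open>P t d\<close> remains,
  as the energy estimate requires. The flow is read off from state and effort.\<close>

lemma classical_solution_unique:
  fixes X :: "'x::{real_inner,complete_space} kspace"
    and E :: "'e::{real_inner,complete_space} kspace"
    and F :: "'f::{real_inner,complete_space} kspace"
  assumes K: "\<real> \<subseteq> K"
    and hilbert: "hilbert K X" "hilbert K E" "hilbert K F"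
    and S: "linear_op K (prod_kspace X E) (prod_kspace X F) D S"
    and diss: "dissipative (prod_kspace X E) D (\<lambda>w. (fst (S w), - \<psi> (snd (S w))))"
    and P: "\<And>t. t \<ge> 0 \<Longrightarrow> bounded_linear (P t)" "\<And>z. C1_halfline (\<lambda>t. P t z)"
      "\<And>t. t \<ge> 0 \<Longrightarrow> bij (P t)"
    and invP: "\<And>t. t \<ge> 0 \<Longrightarrow> bounded_linear (inv (P t))" "\<And>z. C1_halfline (\<lambda>t. inv (P t) z)"
    and G: "\<And>t. t \<ge> 0 \<Longrightarrow> bounded_linear (G t)" "\<And>z. C1_halfline (\<lambda>t. G t z)"
    and sym: "\<And>t x y. t \<ge> 0 \<Longrightarrow> inner (P t x) y = inner x (P t y)"
    and nonneg: "\<And>t x. t \<ge> 0 \<Longrightarrow> inner (P t x) x \<ge> 0"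
    and sol: "classical_solution D S P G e x f" "classical_solution D S P G e' x' f'"
    and e: "\<And>t. t \<ge> 0 \<Longrightarrow> e' t = e t" and "x' 0 = x 0" and "t \<ge> 0"
  shows "x' t = x t" "f' t = f t"
proof -
  have bij: "inv (P t) (P t z) = z" "P t (inv (P t) z) = z" if "t \<ge> 0" for t z
    using P(3)[OF that] by (simp_all add: bij_is_inj bij_is_surj surj_f_inv_f)
  let ?w = "\<lambda>t. (P t (x t), e t)" and ?w' = "\<lambda>t. (P t (x' t), e t)"
  let ?d' = "\<lambda>t. (fst (S (?w' t)) + G t (x' t)) - (fst (S (?w t)) + G t (x t))"
  have eq: "x' t - x t = 0" if "t \<ge> 0" for t
  proof (rule dissipative_evolution_unique[OF P(1,2) invP G, where d = "\<lambda>t. x' t - x t" and d' = ?d'])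
    fix t :: real assume t: "t \<ge> 0"
    have der: "(x has_vector_derivative fst (S (?w t)) + G t (x t)) (at t within {0..})"
      "(x' has_vector_derivative fst (S (?w' t)) + G t (x' t)) (at t within {0..})"
      and dom: "?w t \<in> D" "?w' t \<in> D"
      using sol t e[OF t] by (auto simp: classical_solution_def bij)
    show "((\<lambda>t. x' t - x t) has_vector_derivative ?d' t) (at t within {0..})"
      by (intro has_vector_derivative_diff der)
    have "?w' t - ?w t \<in> D" "S (?w' t - ?w t) = S (?w' t) - S (?w t)"
      using linear_op_real(3,4)[OF S K _ _ dom(2,1)] hilbert
      by (auto simp: prod_kspace_def hilbert_scaleR)
    moreover have "?w' t - ?w t = (P t (x' t - x t), 0)"
      using linear_diff[OF bounded_linear.linear[OF P(1)[OF t]]] by simp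
    ultimately have "(P t (x' t - x t), 0) \<in> D"
      and Sd: "S (P t (x' t - x t), 0) = S (?w' t) - S (?w t)"
      by simp_all
    then have "inner (fst (S (?w' t) - S (?w t))) (P t (x' t - x t)) \<le> 0"
      using diss hilbert_Re_ip[OF hilbert(1)] hilbert_Re_ip[OF hilbert(2)]
      by (fastforce simp: dissipative_def prod_kspace_def)
    then show "inner (?d' t - G t (x' t - x t)) (P t (x' t - x t)) \<le> 0"
      using linear_diff[OF bounded_linear.linear[OF G(1)[OF t]], of "x' t" "x t"]
      by (simp add: inner_add_left inner_diff_left)
  qed (use that bij sym nonneg \<open>x' 0 = x 0\<close> in auto)
  show "x' t = x t" using eq[OF \<open>t \<ge> 0\<close>] by simp
  then show "f' t = f t"
    using sol e \<open>t \<ge> 0\<close> by (simp add: classical_solution_def)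
qed

section \<open>Solutions for prescribed initial state and effort class\<close>

text \<open>An effort datum is an arbitrary representative of an L2 class, whereas a solution
  carries an H1 representative; hence \<open>e1\<close> matches \<open>e\<close> only almost
  everywhere, and uniqueness also covers the representative. The well-posed scattering system enters
  through \<open>represents\<close>.\<close>

theorem corollaryV1:
  fixes K :: "complex set"
    and X :: "'x::{real_inner,complete_space} kspace"
    and E :: "'e::{real_inner,complete_space} kspace"
    and F :: "'f::{real_inner,complete_space} kspace"
    and \<psi> :: "'f \<Rightarrow> 'e"
    and D :: "('x \<times> 'e) set"
    and S :: "'x \<times> 'e \<Rightarrow> 'x \<times> 'f"
    and \<beta> :: complex
    and P G :: "real \<Rightarrow> 'x \<Rightarrow> 'x"
    and \<Sigma> :: "('e, 'x, 'e) tv_system"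
  assumes "K = \<real> \<or> K = UNIV"
    and "hilbert K X" and "hilbert K E" and "hilbert K F"
    and "unitary_op K F E \<psi>"
    and "dirac_node K X E F \<psi> D S"
    and "\<beta> \<in> K" and "Re \<beta> > 0" and "cayley_injective E \<psi> \<beta> D S"
    and "\<And>t. t \<ge> 0 \<Longrightarrow> bounded_op K X X (P t)"
    and "\<And>t. t \<ge> 0 \<Longrightarrow> bounded_op K X X (G t)"
    and "\<And>t x y. t \<ge> 0 \<Longrightarrow> ip X (P t x) y = ip X x (P t y)"
    and "\<And>t x. t \<ge> 0 \<Longrightarrow> Re (ip X (P t x) x) \<ge> 0"
    and "\<And>t. t \<ge> 0 \<Longrightarrow> bij (P t) \<and> bounded_op K X X (inv (P t))"
    and "\<And>z. C2_halfline (\<lambda>t. P t z)"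
    and "\<And>z. C1_halfline (\<lambda>t. inv (P t) z)"
    and "\<And>z. C1_halfline (\<lambda>t. G t z)"
    and "represents K E X E (cayley_dom E \<psi> \<beta> D S) (cayley_op E \<psi> \<beta> D S) P G \<Sigma>"
  shows "\<forall>(x0, e) \<in> effort_data \<beta> (scattering_data (cayley_dom E \<psi> \<beta> D S) P) \<Sigma>.
    \<exists>e1 x f.
      classical_solution D S P G e1 x f \<and> x 0 = x0 \<and> ae_eq e1 e \<and>
      (\<forall>e2 x' f'.
         classical_solution D S P G e2 x' f' \<and> x' 0 = x0 \<and> ae_eq e2 e \<longrightarrow>
         (\<forall>t\<ge>0. e2 t = e1 t \<and> x' t = x t \<and> f' t = f t))"
proof (intro ballI)
  fix p assume p: "p \<in> effort_data \<beta> (scattering_data (cayley_dom E \<psi> \<beta> D S) P) \<Sigma>"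
  note hilbert = assms(2-4) and \<beta> = assms(8)
  let ?D = "cayley_dom E \<psi> \<beta> D S" and ?S = "cayley_op E \<psi> \<beta> D S"
  obtain z e where p_eq: "p = (z, e)" by fastforce
  have K: "\<real> \<subseteq> K" "\<beta> \<in> K" "cnj \<beta> \<in> K"
    using assms(1) \<open>\<beta> \<in> K\<close> by (auto simp: Reals_cnj_iff)
  have S: "linear_op K (prod_kspace X E) (prod_kspace X F) D S"
    and diss: "dissipative (prod_kspace X E) D (\<lambda>w. (fst (S w), - \<psi> (snd (S w))))"
    using assms(6) by (simp_all add: dirac_node_def maximal_dissipative_def)
  have P: "bounded_linear (P t)" "bij (P t)" "bounded_linear (inv (P t))"
    and G: "bounded_linear (G t)" if "t \<ge> 0" for t
    using assms(10,11,14)[OF that] bounded_op_imp_bounded_linear[OF _ K(1) hilbert(1,1)] by auto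
  have sym: "inner (P t x) y = inner x (P t y)" if "t \<ge> 0" for t x y
    using assms(12)[OF that, of x y] by (simp flip: hilbert_Re_ip[OF hilbert(1)])
  have nonneg: "inner (P t x) x \<ge> 0" if "t \<ge> 0" for t x
    using assms(13)[OF that, of x] by (simp add: hilbert_Re_ip[OF hilbert(1)])
  obtain x0 u where u: "(x0, u) \<in> scattering_data ?D P" and e: "L2_loc e"
    and z: "((\<lambda>t::real. sqrt (2 * Re \<beta>) *\<^sub>R x0) \<longlongrightarrow> z) at_top"
    and lim: "\<And>\<tau>. \<tau> \<ge> 0 \<Longrightarrow> ((\<lambda>t. L2_norm_on {0..\<tau>}
      (\<lambda>s. output_map \<Sigma> t 0 x0 s + u s + io_map \<Sigma> t 0 (cut 0 t u) s - e s)) \<longlongrightarrow> 0) at_top"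
    using p by (auto simp: p_eq effort_data_def)
  have z_eq: "z = sqrt (2 * Re \<beta>) *\<^sub>R x0"
    using z by (simp add: tendsto_const_iff)
  obtain x y where sol: "classical_solution ?D ?S P G u x y" "x 0 = x0"
    and mild: "mild_solution \<Sigma> x0 u x y"
    using assms(18) u unfolding represents_def by blast
  let ?e = "\<lambda>t. u t + y t" and ?x = "\<lambda>t. sqrt (2 * Re \<beta>) *\<^sub>R x t"
    and ?f = "\<lambda>t. inv \<psi> (sc E (cnj \<beta>) (u t) - sc E \<beta> (y t))"
  have sol': "classical_solution D S P G ?e ?x ?f"
    using classical_solution_of_cayley_op[OF K hilbert assms(5) S \<beta> assms(9) _ _ _ sol(1)] P G
    by (simp add: bounded_linear.linear)
  have ae: "ae_eq ?e e"
    using mild e lim by (rule mild_solution_effort_limit)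
  have "\<forall>t\<ge>0. e' t = ?e t \<and> x' t = ?x t \<and> f' t = ?f t"
    if "classical_solution D S P G e' x' f'" "x' 0 = z" "ae_eq e' e" for e' x' f'
  proof -
    \<comment> \<open>Both efforts are H1 functions in the class of \<open>e\<close>, so they agree
      at every time; this pointwise equality is what the uniqueness of state and flow starts
      from.\<close>
    have "ae_eq e' ?e"
      using that(3) ae unfolding ae_eq_def by eventually_elim simp
    then have e': "e' t = ?e t" if "t \<ge> 0" for t
      using H1_loc_ae_eq_imp_eq[of e' ?e t] that sol' \<open>classical_solution D S P G e' x' f'\<close>
      by (simp add: classical_solution_def)
    note unique = classical_solution_unique[OF K(1) hilbert S diss P(1)
        C2_halfline_imp_C1_halfline[OF assms(15)] P(2,3) assms(16) G assms(17) sym nonneg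
        sol' that(1) e']
    show ?thesis
      using e' unique that(2) sol(2) z_eq by simp
  qed
  with sol' ae sol(2) z_eq show "case p of (x0, e) \<Rightarrow>
    \<exists>e1 x f. classical_solution D S P G e1 x f \<and> x 0 = x0 \<and> ae_eq e1 e \<and>
      (\<forall>e2 x' f'. classical_solution D S P G e2 x' f' \<and> x' 0 = x0 \<and> ae_eq e2 e \<longrightarrow>
         (\<forall>t\<ge>0. e2 t = e1 t \<and> x' t = x t \<and> f' t = f t))"
    unfolding p_eq prod.case by (intro exI[of _ ?e] exI[of _ ?x] exI[of _ ?f]) blast
qed

end
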